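(* Let $\mathbb{K}$ be a field, $n\ge 1$, and let $K_n=K_{n,\Gamma}^{P,Q}(\mathbb{K})$ be the algebra defined in the context. Suppose that $p_i=1$ and that $q_i$ is not a root of unity for every $1\le i\le n$. If $M$ is a nonzero finitely generated (right) $K_n$-module that is not a $\mathscr{Z}$-torsion module, then $$\operatorname{GK-dim}(M)\ \ge\ n=\frac{\operatorname{GK-dim}(K_n)}{2}.$$
   Context: Definition of $K_n$: let $P=(p_1,\ldots,p_n)$ and $Q=(q_1,\ldots,q_n)$ be $n$-tuples of elements of $\mathbb{K}^*$ with $p_i\ne q_i$ for all $i$, and let $\Gamma=(\gamma_{ij})$ be a multiplicatively antisymmetric $n\times n$ matrix over $\mathbb{K}$ (that is, $\gamma_{ii}=1$ and $\gamma_{ij}\gamma_{ji}=1$ for all $i,j$). The algebra $K_n=K_{n,\Gamma}^{P,Q}(\mathbb{K})$ is the $\mathbb{K}$-algebra generated by $x_1,y_1,\ldots,x_n,y_n$ subject to the relations $x_ix_j=q_ip_j^{-1}\gamma_{ij}x_jx_i$ for $i<j$; $y_iy_j=\gamma_{ij}y_jy_i$ for $i<j$; $x_iy_j=p_j\gamma_{ij}^{-1}y_jx_i$ for $i<j$; $x_iy_j=q_j\gamma_{ij}^{-1}y_jx_i$ for $i>j$; $x_iy_i-q_iy_ix_i=\sum_{l=1}^{i-1}(q_l-p_l)y_lx_l$ for all $i$. It is an affine noetherian domain. The elements $z_i:=\sum_{l\le i}(q_l-p_l)y_lx_l$ ($1\le i\le n$) are normal in $K_n$ and commute with each other, and $\mathscr{Z}:=\{z_1^{j_1}\cdots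 z_n^{j_n}: j_i\in\mathbb{Z}_{\ge 0}\}$ is an Ore set in $K_n$. A module $M$ is $\mathscr{Z}$-torsion if every $m\in M$ satisfies $ms=0$ for some $s\in\mathscr{Z}$. $\operatorname{GK-dim}$ denotes Gelfand--Kirillov dimension over $\mathbb{K}$. *)

theory Defs
  imports
    "HOL-Library.Poly_Mapping"
    "HOL-Library.Extended_Real"
    "HOL-Library.Liminf_Limsup"
    "HOL.Transcendental"
begin

section \<open>Algebras over a field and right modules\<close>

locale kalgebra = vector_space scale
  for scale :: "'k::field \<Rightarrow> 'a::ring_1 \<Rightarrow> 'a" +
  assumes scale_mult_left: "scale c a * b = scale c (a * b)"
    and scale_mult_right: "a * scale c b = scale c (a * b)"

locale right_module =
  fixes act :: "'m::ab_group_add \<Rightarrow> 'a::ring_1 \<Rightarrow> 'm"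
  assumes act_add_left: "act (u + v) a = act u a + act v a"
    and act_add_right: "act u (a + b) = act u a + act u b"
    and act_mult: "act u (a * b) = act (act u a) b"
    and act_one: "act u 1 = u"

definition fg_right_module :: "('m::ab_group_add \<Rightarrow> 'a::ring_1 \<Rightarrow> 'm) \<Rightarrow> bool" where
  "fg_right_module act \<longleftrightarrow>
     (\<exists>S. finite S \<and> (\<forall>u. \<exists>r. u = (\<Sum>s\<in>S. act s (r s))))"

definition module_scale ::
    "('k \<Rightarrow> 'a::ring_1 \<Rightarrow> 'a) \<Rightarrow> ('m \<Rightarrow> 'a \<Rightarrow> 'm) \<Rightarrow> 'k \<Rightarrow> 'm \<Rightarrow> 'm" where
  "module_scale scale act c u = act u (scale c 1)"

lemma vector_space_module_scale:
  fixes scale :: "'k::field \<Rightarrow> 'a::ring_1 \<Rightarrow> 'a"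
    and act :: "'m::ab_group_add \<Rightarrow> 'a \<Rightarrow> 'm"
  assumes "kalgebra scale" and "right_module act"
  shows "vector_space (module_scale scale act)"
proof -
  interpret A: kalgebra scale by fact
  interpret M: right_module act by fact
  have mult: "scale (c * d) 1 = scale d 1 * scale c 1" for c d
    by (simp add: A.scale_mult_left A.scale_mult_right mult.commute)
  show ?thesis
    by unfold_locales
      (simp_all add: module_scale_def M.act_add_left A.scale_left_distrib M.act_add_right
        mult M.act_mult M.act_one)
qed


section \<open>Gelfand--Kirillov dimension\<close>

text \<open>
  For finite-dimensional subspaces \<open>V\<close> of an algebra and \<open>F\<close> of a right module, let
  \<open>V\<^sup>(\<^sup>m\<^sup>) = K + V + V\<^sup>2 + \<dots> + V\<^sup>m\<close>.  The dimension of the algebra is the supremum over \<open>V\<close> of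
  \<open>limsup\<^sub>m log\<^sub>m dim V\<^sup>(\<^sup>m\<^sup>)\<close>, that of the module is the supremum over \<open>V\<close> and \<open>F\<close> of
  \<open>limsup\<^sub>m log\<^sub>m dim (F V\<^sup>(\<^sup>m\<^sup>))\<close>.  The logarithm of \<open>0\<close> is taken to be \<open>-\<infinity>\<close>.
\<close>

definition findim_subspace :: "('k::field \<Rightarrow> 'v::ab_group_add \<Rightarrow> 'v) \<Rightarrow> 'v set \<Rightarrow> bool" where
  "findim_subspace scale V \<longleftrightarrow> (\<exists>B. finite B \<and> V = module.span scale B)"

definition power_filtration ::
    "('k::field \<Rightarrow> 'a::ring_1 \<Rightarrow> 'a) \<Rightarrow> 'a set \<Rightarrow> nat \<Rightarrow> 'a set" where
  "power_filtration scale V m =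
     module.span scale {prod_list vs | vs. set vs \<subseteq> V \<and> length vs \<le> m}"

definition growth_exponent :: "(nat \<Rightarrow> nat) \<Rightarrow> ereal" where
  "growth_exponent d =
     limsup (\<lambda>m. if d m = 0 then - \<infinity> else ereal (log (real m) (real (d m))))"

definition GKdim_algebra :: "('k::field \<Rightarrow> 'a::ring_1 \<Rightarrow> 'a) \<Rightarrow> ereal" where
  "GKdim_algebra scale =
     (SUP V \<in> Collect (findim_subspace scale).
        growth_exponent (\<lambda>m. vector_space.dim scale (power_filtration scale V m)))"

definition GKdim_module ::
    "('k::field \<Rightarrow> 'a::ring_1 \<Rightarrow> 'a) \<Rightarrow> ('m::ab_group_add \<Rightarrow> 'a \<Rightarrow> 'm) \<Rightarrow> ereal" where
  "GKdim_module scale act =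
     (SUP V \<in> Collect (findim_subspace scale).
      SUP F \<in> Collect (findim_subspace (module_scale scale act)).
        growth_exponent (\<lambda>m. vector_space.dim (module_scale scale act)
          (module.span (module_scale scale act)
             {act u a | u a. u \<in> F \<and> a \<in> power_filtration scale V m})))"


section \<open>Free algebras and presentations\<close>

text \<open>
  Words form the free monoid, so the convolution product on \<open>'g list \<Rightarrow>\<^sub>0 'k\<close> makes it the
  free algebra on \<open>'g\<close>.
\<close>

instantiation list :: (type) monoid_add
begin

definition zero_list :: "'a list" where "zero_list = []"

definition plus_list :: "'a list \<Rightarrow> 'a list \<Rightarrow> 'a list" where "plus_list = (@)"

instance by standard (simp_all add: zero_list_def plus_list_def)

end

type_synonym ('g, 'k) ncpoly = "'g list \<Rightarrow>\<^sub>0 'k"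

definition Const :: "'k \<Rightarrow> ('g, 'k::field) ncpoly" where
  "Const c = Poly_Mapping.single [] c"

definition Var :: "'g \<Rightarrow> ('g, 'k::field) ncpoly" where
  "Var g = Poly_Mapping.single [g] 1"

definition free_algebra :: "'g set \<Rightarrow> ('g, 'k::field) ncpoly set" where
  "free_algebra G = {f. \<forall>w \<in> Poly_Mapping.keys f. set w \<subseteq> G}"

inductive_set relation_ideal ::
    "'g set \<Rightarrow> ('g, 'k::field) ncpoly set \<Rightarrow> ('g, 'k) ncpoly set"
  for G :: "'g set" and R :: "('g, 'k) ncpoly set" where
  zero: "0 \<in> relation_ideal G R"
| add: "f \<in> relation_ideal G R \<Longrightarrow> r \<in> R \<Longrightarrow> u \<in> free_algebra G \<Longrightarrow> v \<in> free_algebra G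
    \<Longrightarrow> f + u * r * v \<in> relation_ideal G R"

definition eval_ncpoly ::
    "('k::field \<Rightarrow> 'a::ring_1 \<Rightarrow> 'a) \<Rightarrow> ('g \<Rightarrow> 'a) \<Rightarrow> ('g, 'k) ncpoly \<Rightarrow> 'a" where
  "eval_ncpoly scale a f =
     (\<Sum>w \<in> Poly_Mapping.keys f. scale (Poly_Mapping.lookup f w) (prod_list (map a w)))"

text \<open>
  The algebra is generated by the family \<open>a\<close>, indexed by \<open>G\<close>, subject to the relations \<open>r = 0\<close>
  for \<open>r \<in> R\<close>: evaluation induces an isomorphism from the free algebra on \<open>G\<close> modulo the
  two-sided ideal generated by \<open>R\<close>.
\<close>

definition presented_by ::
    "('k::field \<Rightarrow> 'a::ring_1 \<Rightarrow> 'a) \<Rightarrow> 'g set \<Rightarrow> ('g, 'k) ncpoly set \<Rightarrow> ('g \<Rightarrow> 'a) \<Rightarrow> bool" where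
  "presented_by scale G R a \<longleftrightarrow>
     kalgebra scale \<and>
     eval_ncpoly scale a ` free_algebra G = UNIV \<and>
     {f \<in> free_algebra G. eval_ncpoly scale a f = 0} = relation_ideal G R"


section \<open>The algebra \<open>K\<^sub>n\<close>\<close>

datatype Kn_gen = GX nat | GY nat

definition Kn_gens :: "nat \<Rightarrow> Kn_gen set" where
  "Kn_gens n = GX ` {1..n} \<union> GY ` {1..n}"

abbreviation X :: "nat \<Rightarrow> (Kn_gen, 'k::field) ncpoly" where "X i \<equiv> Var (GX i)"

abbreviation Y :: "nat \<Rightarrow> (Kn_gen, 'k::field) ncpoly" where "Y i \<equiv> Var (GY i)"

definition Kn_rels ::
    "nat \<Rightarrow> (nat \<Rightarrow> 'k::field) \<Rightarrow> (nat \<Rightarrow> 'k) \<Rightarrow> (nat \<Rightarrow> nat \<Rightarrow> 'k) \<Rightarrow> (Kn_gen, 'k) ncpoly set" where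
  "Kn_rels n p q \<gamma> =
     {X i * X j - Const (q i * inverse (p j) * \<gamma> i j) * (X j * X i) | i j. 1 \<le> i \<and> i < j \<and> j \<le> n}
   \<union> {Y i * Y j - Const (\<gamma> i j) * (Y j * Y i) | i j. 1 \<le> i \<and> i < j \<and> j \<le> n}
   \<union> {X i * Y j - Const (p j * inverse (\<gamma> i j)) * (Y j * X i) | i j. 1 \<le> i \<and> i < j \<and> j \<le> n}
   \<union> {X i * Y j - Const (q j * inverse (\<gamma> i j)) * (Y j * X i) | i j. 1 \<le> j \<and> j < i \<and> i \<le> n}
   \<union> {X i * Y i - Const (q i) * (Y i * X i) - (\<Sum>l = 1..<i. Const (q l - p l) * (Y l * X l))
        | i. 1 \<le> i \<and> i \<le> n}"

definition Kn_parameters ::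
    "nat \<Rightarrow> (nat \<Rightarrow> 'k::field) \<Rightarrow> (nat \<Rightarrow> 'k) \<Rightarrow> (nat \<Rightarrow> nat \<Rightarrow> 'k) \<Rightarrow> bool" where
  "Kn_parameters n p q \<gamma> \<longleftrightarrow>
     (\<forall>i \<in> {1..n}. p i \<noteq> 0 \<and> q i \<noteq> 0 \<and> p i \<noteq> q i) \<and>
     (\<forall>i \<in> {1..n}. \<gamma> i i = 1) \<and>
     (\<forall>i \<in> {1..n}. \<forall>j \<in> {1..n}. \<gamma> i j * \<gamma> j i = 1)"

definition is_Kn ::
    "nat \<Rightarrow> (nat \<Rightarrow> 'k::field) \<Rightarrow> (nat \<Rightarrow> 'k) \<Rightarrow> (nat \<Rightarrow> nat \<Rightarrow> 'k)
      \<Rightarrow> ('k \<Rightarrow> 'a::ring_1 \<Rightarrow> 'a) \<Rightarrow> (nat \<Rightarrow> 'a) \<Rightarrow> (nat \<Rightarrow> 'a) \<Rightarrow> bool" where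
  "is_Kn n p q \<gamma> scale x y \<longleftrightarrow>
     presented_by scale (Kn_gens n) (Kn_rels n p q \<gamma>) (case_Kn_gen x y)"

definition Kn_z ::
    "(nat \<Rightarrow> 'k::field) \<Rightarrow> (nat \<Rightarrow> 'k) \<Rightarrow> ('k \<Rightarrow> 'a::ring_1 \<Rightarrow> 'a) \<Rightarrow> (nat \<Rightarrow> 'a) \<Rightarrow> (nat \<Rightarrow> 'a)
      \<Rightarrow> nat \<Rightarrow> 'a" where
  "Kn_z p q scale x y i = (\<Sum>l = 1..i. scale (q l - p l) (y l * x l))"

definition Kn_Zset ::
    "nat \<Rightarrow> (nat \<Rightarrow> 'k::field) \<Rightarrow> (nat \<Rightarrow> 'k) \<Rightarrow> ('k \<Rightarrow> 'a::ring_1 \<Rightarrow> 'a) \<Rightarrow> (nat \<Rightarrow> 'a) \<Rightarrow> (nat \<Rightarrow> 'a)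
      \<Rightarrow> 'a set" where
  "Kn_Zset n p q scale x y =
     {prod_list (map (\<lambda>i. Kn_z p q scale x y i ^ j i) [1..<Suc n]) | j :: nat \<Rightarrow> nat. True}"

definition torsion_module :: "'a set \<Rightarrow> ('m::zero \<Rightarrow> 'a \<Rightarrow> 'm) \<Rightarrow> bool" where
  "torsion_module S act \<longleftrightarrow> (\<forall>u. \<exists>s \<in> S. act u s = 0)"

end

theory Submission
  imports Defs "HOL-Library.FuncSet"
begin

text \<open>
  Every \<open>z\<^sub>i\<close> commutes up to a nonzero scalar with all generators, and so do \<open>x\<^sub>i\<close> and \<open>x\<^sub>j\<close>; hence
  left multiplication by \<open>z\<^sub>i\<close> or \<open>x\<^sub>i\<close>, compared with right multiplication, has the monomials
  \<open>z\<^sup>k x\<^sup>a\<close> as eigenvectors, and since no \<open>q\<^sub>i\<close> is a root of unity the eigenvalues separate them.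
  Let \<open>u\<close> be a vector killed by no element of \<open>Z\<close>.  If a nontrivial combination of monomials with
  exponents at most \<open>D\<close> kills \<open>u V\<^sup>(\<^sup>m\<^sup>)\<close> with \<open>m\<close> of order \<open>D\<close>, then taking commutators isolates a single
  monomial, at the cost of a linear number of filtration steps.  Commutators with \<open>y\<^sub>i\<close> then
  turn each factor \<open>x\<^sub>i\<close> into a factor \<open>z\<^sub>i\<close>, because \<open>x\<^sub>i\<^sup>b y\<^sub>i - y\<^sub>i x\<^sub>i\<^sup>b\<close> is a nonzero multiple of
  \<open>z\<^sub>i x\<^sub>i\<^sup>b\<^sup>-\<^sup>1\<close>, and an element of \<open>Z\<close> kills \<open>u\<close>, a contradiction.  So the about
  \<open>D\<^sup>2\<^sup>n\<close> monomials act independently from \<open>u V\<^sup>(\<^sup>m\<^sup>)\<close> to \<open>u V\<^sup>(\<^sup>m\<^sup>+\<^sup>2\<^sup>n\<^sup>D\<^sup>)\<close>, which is Bernstein's inequality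
  for the module.  The same independence bounds the dimension of the algebra from below, so that no
  PBW theorem is needed; the upper bound only needs that the products of \<open>z\<^sup>k\<close> with powers of one of
  \<open>x\<^sub>i\<close>, \<open>y\<^sub>i\<close> for every \<open>i\<close> span.
\<close>

section \<open>Commutation up to nonzero scalars in an algebra\<close>

context kalgebra
begin

text \<open>For fixed \<open>a\<close> and \<open>c\<close> these \<open>b\<close> form the
  eigenspace of eigenvalue \<open>c\<close> for left multiplication by \<open>a\<close> compared
  with right multiplication by \<open>a\<close>. Requiring \<open>c \<noteq> 0\<close> makes the
  relation symmetric up to inverting \<open>c\<close>.\<close>

definition qcom :: "'k \<Rightarrow> 'a \<Rightarrow> 'a \<Rightarrow> bool" where
  "qcom c a b \<longleftrightarrow> c \<noteq> 0 \<and> a * b = scale c (b * a)"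

text \<open>Subspaces and annihilators do not see nonzero scalars, so most products have to be
  tracked only up to this equivalence.\<close>

definition sim :: "'a \<Rightarrow> 'a \<Rightarrow> bool" where
  "sim a b \<longleftrightarrow> (\<exists>c. c \<noteq> 0 \<and> a = scale c b)"

definition com :: "'a \<Rightarrow> 'a \<Rightarrow> bool" where
  "com a b \<longleftrightarrow> (\<exists>c. qcom c a b)"

lemma sim_refl [simp]: "sim a a"
  unfolding sim_def by (rule exI[of _ 1]) simp

lemma sim_sym: "sim a b \<Longrightarrow> sim b a"
  unfolding sim_def by (metis field_class.field_inverse inverse_nonzero_iff_nonzero scale_one scale_scale)

lemma sim_trans [trans]: "sim a b \<Longrightarrow> sim b c \<Longrightarrow> sim a c"
  unfolding sim_def by (metis no_zero_divisors scale_scale)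

lemma sim_mult: "sim a b \<Longrightarrow> sim c d \<Longrightarrow> sim (a * c) (b * d)"
  unfolding sim_def by (metis no_zero_divisors scale_mult_left scale_mult_right scale_scale)

lemma com_iff_sim: "com a b \<longleftrightarrow> sim (a * b) (b * a)"
  by (auto simp: com_def qcom_def sim_def)

lemma qcom_sym: "qcom c a b \<Longrightarrow> qcom (inverse c) b a"
  unfolding qcom_def by simp

lemma qcom_mult_right:
  assumes "qcom c a b" "qcom d a e" shows "qcom (c * d) a (b * e)"
proof -
  have "a * (b * e) = scale c (b * (a * e))"
    using assms(1) by (metis mult.assoc qcom_def scale_mult_left)
  also have "\<dots> = scale (c * d) (b * e * a)"
    using assms(2) by (simp add: qcom_def scale_mult_right mult.assoc)
  finally show ?thesis using assms by (simp add: qcom_def)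
qed

lemma qcom_one_right [simp]: "qcom 1 a 1"
  by (simp add: qcom_def)

lemma qcom_power_right: "qcom c a b \<Longrightarrow> qcom (c ^ k) a (b ^ k)"
  by (induction k) (auto intro: qcom_mult_right)

lemma qcom_prod_list_right:
  "(\<And>i. i \<in> set is \<Longrightarrow> qcom (c i) a (f i)) \<Longrightarrow>
    qcom (prod_list (map c is)) a (prod_list (map f is))"
  by (induction "is") (auto intro: qcom_mult_right)

lemma qcom_add_right: "qcom c a b \<Longrightarrow> qcom c a e \<Longrightarrow> qcom c a (b + e)"
  by (simp add: qcom_def distrib_left distrib_right scale_right_distrib)

lemma qcom_scale_right: "qcom c a b \<Longrightarrow> qcom c a (scale d b)"
  by (simp add: qcom_def scale_mult_left scale_mult_right mult.commute)

lemma qcom_zero_right: "c \<noteq> 0 \<Longrightarrow> qcom c a 0"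
  by (simp add: qcom_def)

lemma com_sym: "com a b \<Longrightarrow> com b a"
  unfolding com_def using qcom_sym by blast

lemma com_refl [simp]: "com a a"
  by (simp add: com_iff_sim)

lemma com_one_right [simp]: "com a 1"
  by (simp add: com_iff_sim)

lemma com_mult_right: "com a b \<Longrightarrow> com a e \<Longrightarrow> com a (b * e)"
  unfolding com_def using qcom_mult_right by blast

lemma com_power_right: "com a b \<Longrightarrow> com a (b ^ k)"
  unfolding com_def using qcom_power_right by blast

lemma com_prod_list_right:
  "(\<And>b. b \<in> set bs \<Longrightarrow> com a b) \<Longrightarrow> com a (prod_list bs)"
  by (induction bs) (auto intro: com_mult_right)


end

section \<open>Ordered products\<close>

text \<open>The increasing order of the factors is the one used in \<open>Kn_Zset\<close>; it
  matters because the factors commute only up to scalars.\<close>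

definition oprod :: "nat \<Rightarrow> (nat \<Rightarrow> 'a::monoid_mult) \<Rightarrow> 'a" where
  "oprod n f = prod_list (map f [1..<Suc n])"

lemma oprod_cong: "(\<And>i. i \<in> {1..n} \<Longrightarrow> f i = g i) \<Longrightarrow> oprod n f = oprod n g"
  unfolding oprod_def by (intro arg_cong[of _ _ prod_list] map_cong) auto

lemma oprod_eq_one: "(\<And>i. i \<in> {1..n} \<Longrightarrow> f i = 1) \<Longrightarrow> oprod n f = 1"
proof -
  assume "\<And>i. i \<in> {1..n} \<Longrightarrow> f i = 1"
  then have "oprod n f = oprod n (\<lambda>_. 1)" by (rule oprod_cong)
  also have "\<dots> = 1" by (simp add: oprod_def map_replicate_const)
  finally show ?thesis .
qed

lemma oprod_conv_prod: "oprod n f = prod f {1..n}" for f :: "nat \<Rightarrow> 'a::comm_monoid_mult"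
proof -
  have "prod f {1..n} = prod f (set [1..<Suc n])"
    by (simp add: atLeastLessThanSuc_atLeastAtMost del: upt_Suc)
  also have "\<dots> = oprod n f"
    unfolding oprod_def by (rule prod.distinct_set_conv_list) simp
  finally show ?thesis ..
qed

lemma oprod_split:
  assumes "i \<in> {1..n}"
  shows "oprod n f =
    prod_list (map f [1..<i]) * f i * prod_list (map f [Suc i..<Suc n])"
proof -
  have "[1..<Suc n] = [1..<i] @ i # [Suc i..<Suc n]"
  proof -
    have "[1..<Suc n] = [1..<i] @ [i..<Suc n]"
      using assms upt_add_eq_append[of 1 i "Suc n - i"] by (simp del: upt_Suc)
    also have "[i..<Suc n] = i # [Suc i..<Suc n]"
      using assms by (intro upt_conv_Cons) auto
    finally show ?thesis .
  qed
  then show ?thesis unfolding oprod_def by (simp add: mult.assoc)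
qed

lemma oprod_update:
  assumes "i \<in> {1..n}"
  shows "oprod n (f(i := a)) =
    prod_list (map f [1..<i]) * a * prod_list (map f [Suc i..<Suc n])"
proof -
  have "map (f(i := a)) [1..<i] = map f [1..<i]"
    "map (f(i := a)) [Suc i..<Suc n] = map f [Suc i..<Suc n]"
    by (auto intro!: map_cong simp del: upt_Suc)
  then show ?thesis unfolding oprod_split[OF assms, of "f(i := a)"] by simp
qed

context kalgebra
begin

lemma oprod_update_linear:
  assumes "i \<in> {1..n}"
  shows oprod_update_add: "oprod n (f(i := a + b)) = oprod n (f(i := a)) + oprod n (f(i := b))"
    and oprod_update_scale: "oprod n (f(i := scale c a)) = scale c (oprod n (f(i := a)))"
  unfolding oprod_update[OF assms]
  by (simp_all add: distrib_left distrib_right scale_mult_left scale_mult_right)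

lemma com_oprod: "(\<And>j. j \<in> {1..n} \<Longrightarrow> com a (f j)) \<Longrightarrow> com a (oprod n f)"
  unfolding oprod_def by (rule com_prod_list_right) (auto simp del: upt_Suc)

lemma qcom_oprod: "(\<And>j. j \<in> {1..n} \<Longrightarrow> qcom (c j) a (f j)) \<Longrightarrow> qcom (\<Prod>j\<in>{1..n}. c j) a (oprod n f)"
  unfolding oprod_conv_prod[symmetric] oprod_def
  by (rule qcom_prod_list_right) (auto simp del: upt_Suc)

text \<open>The factor \<open>b\<close> travels left past the factors of larger index, picking up a
  nonzero scalar each time, until it meets the factor with index \<open>i\<close>.\<close>

lemma oprod_mult_right:
  assumes i: "i \<in> {1..n}" and "\<And>j. j \<in> {1..n} - {i} \<Longrightarrow> com b (f j)"
  shows "sim (oprod n f * b) (oprod n (f(i := f i * b)))"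
proof -
  have "com b (prod_list (map f [Suc i..<Suc n]))"
    using assms by (intro com_prod_list_right) (auto simp del: upt_Suc)
  then have "sim (prod_list (map f [Suc i..<Suc n]) * b) (b * prod_list (map f [Suc i..<Suc n]))"
    using com_sym com_iff_sim by blast
  then show ?thesis
    unfolding oprod_update[OF i] oprod_split[OF i, of f]
    using sim_mult[OF sim_refl] by (metis mult.assoc)
qed

lemma oprod_mult_left:
  assumes i: "i \<in> {1..n}" and "\<And>j. j \<in> {1..n} - {i} \<Longrightarrow> com b (f j)"
  shows "sim (b * oprod n f) (oprod n (f(i := b * f i)))"
proof -
  have "com b (prod_list (map f [1..<i]))"
    using assms by (intro com_prod_list_right) (auto simp del: upt_Suc)
  then have "sim (b * prod_list (map f [1..<i])) (prod_list (map f [1..<i]) * b)"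
    using com_iff_sim by blast
  then show ?thesis
    unfolding oprod_update[OF i] oprod_split[OF i, of f]
    using sim_mult[OF _ sim_refl] by (metis mult.assoc)
qed

end

section \<open>Linear systems\<close>

text \<open>Gaussian elimination, by induction on the equations: an unknown \<open>i0\<close>
  occurring in equation \<open>j0\<close> is eliminated from the others, which leaves one equation
  and one unknown fewer.\<close>

lemma homogeneous_system_solvable:
  fixes A :: "'i \<Rightarrow> 'j \<Rightarrow> 'k::field"
  assumes "finite J" "finite I" "card J < card I"
  shows "\<exists>c. (\<exists>i\<in>I. c i \<noteq> 0) \<and> (\<forall>j\<in>J. (\<Sum>i\<in>I. c i * A i j) = 0)"
  using assms
proof (induction J arbitrary: I A rule: finite_induct)
  case empty
  then show ?case by (intro exI[of _ "\<lambda>_. 1"]) (auto simp: card_gt_0_iff)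
next
  case (insert j0 J)
  show ?case
  proof (cases "\<forall>i\<in>I. A i j0 = 0")
    case True
    with insert.IH[of I A] insert.prems insert.hyps show ?thesis by auto
  next
    case False
    then obtain i0 where i0: "i0 \<in> I" "A i0 j0 \<noteq> 0" by blast
    let ?I = "I - {i0}"
    define t where "t i = A i j0 / A i0 j0" for i
    have "card J < card ?I" using insert.prems insert.hyps i0 by simp
    then obtain c where c: "\<exists>i\<in>?I. c i \<noteq> 0"
      and sys: "\<And>j. j \<in> J \<Longrightarrow> (\<Sum>i\<in>?I. c i * (A i j - t i * A i0 j)) = 0"
      using insert.IH[of ?I "\<lambda>i j. A i j - t i * A i0 j"] insert.prems by auto
    \<comment> \<open>The value at \<open>i0\<close> is the one that equation \<open>j0\<close>
      forces.\<close>
    define d where "d = c(i0 := - (\<Sum>i\<in>?I. c i * t i))"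
    have split: "(\<Sum>i\<in>I. d i * A i j) = (\<Sum>i\<in>?I. c i * (A i j - t i * A i0 j))" for j
    proof -
      have "(\<Sum>i\<in>I. d i * A i j) = d i0 * A i0 j + (\<Sum>i\<in>?I. d i * A i j)"
        using i0 insert.prems by (simp add: sum.remove)
      also have "(\<Sum>i\<in>?I. d i * A i j) = (\<Sum>i\<in>?I. c i * A i j)"
        by (intro sum.cong) (auto simp: d_def)
      also have "d i0 * A i0 j + \<dots> = (\<Sum>i\<in>?I. c i * (A i j - t i * A i0 j))"
        by (simp add: d_def right_diff_distrib sum_subtractf sum_distrib_right mult.assoc)
      finally show ?thesis .
    qed
    have "(\<Sum>i\<in>I. d i * A i j) = 0" if "j \<in> insert j0 J" for j
    proof (cases "j = j0")
      case True
      then show ?thesis unfolding split using i0 by (simp add: t_def)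
    next
      case False
      then show ?thesis unfolding split using sys that by auto
    qed
    moreover have "\<exists>i\<in>I. d i \<noteq> 0" using c by (auto simp: d_def)
    ultimately show ?thesis by blast
  qed
qed

context vector_space
begin

text \<open>In coordinates with respect to a basis of \<open>W\<close>, too many vectors would give
  a homogeneous system with more unknowns than equations. The finite set \<open>T\<close> ensures
  that the basis is finite, so that \<open>dim\<close> is the true dimension.\<close>

lemma card_le_dim:
  assumes fin: "finite T" "W \<subseteq> span T" and I: "finite I" "\<And>i. i \<in> I \<Longrightarrow> v i \<in> W"
    and indep: "\<And>c. (\<Sum>i\<in>I. scale (c i) (v i)) = 0 \<Longrightarrow> \<forall>i\<in>I. c i = 0"
  shows "card I \<le> dim W"
proof (rule ccontr)
  assume less: "\<not> card I \<le> dim W"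
  obtain B where B: "B \<subseteq> W" "independent B" "W \<subseteq> span B" "card B = dim W"
    using basis_exists by blast
  then have finB: "finite B" using independent_span_bound[OF fin(1) B(2)] fin by blast
  obtain c where c: "\<exists>i\<in>I. c i \<noteq> 0"
    and sys: "\<And>b. b \<in> B \<Longrightarrow> (\<Sum>i\<in>I. c i * representation B (v i) b) = 0"
    using homogeneous_system_solvable[OF finB I(1), of "\<lambda>i. representation B (v i)"] less B(4)
    by (metis not_le)
  have "(\<Sum>i\<in>I. scale (c i) (v i)) = (\<Sum>i\<in>I. scale (c i) (\<Sum>b\<in>B. scale (representation B (v i) b) b))"
    using B I finB by (intro sum.cong refl arg_cong[of _ _ "scale _"] sum_representation_eq[symmetric]) auto
  also have "\<dots> = (\<Sum>b\<in>B. scale (\<Sum>i\<in>I. c i * representation B (v i) b) b)"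
    by (simp add: scale_sum_right scale_sum_left) (rule sum.swap)
  also have "\<dots> = 0" using sys by simp
  finally show False using indep c by blast
qed

text \<open>This is the bound given by dim Hom(U, W) = dim U * dim W. The equations are indexed by
  pairs of basis vectors: each states that one coordinate of the combined map vanishes at one basis
  vector of \<open>U\<close>.\<close>

lemma card_le_dim_mult_dim:
  assumes fin: "finite T" "U \<subseteq> span T" "finite T'" "W \<subseteq> span T'"
    and I: "finite I"
    and lin: "\<And>i. i \<in> I \<Longrightarrow> Vector_Spaces.linear scale scale (f i)"
    and maps: "\<And>i u. i \<in> I \<Longrightarrow> u \<in> U \<Longrightarrow> f i u \<in> W"
    and indep: "\<And>c. (\<And>u. u \<in> U \<Longrightarrow> (\<Sum>i\<in>I. scale (c i) (f i u)) = 0) \<Longrightarrow> \<forall>i\<in>I. c i = 0"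
  shows "card I \<le> dim U * dim W"
proof (rule ccontr)
  assume less: "\<not> card I \<le> dim U * dim W"
  obtain A where A: "A \<subseteq> U" "independent A" "U \<subseteq> span A" "card A = dim U"
    using basis_exists by blast
  then have finA: "finite A" using independent_span_bound[OF fin(1) A(2)] fin by blast
  obtain B where B: "B \<subseteq> W" "independent B" "W \<subseteq> span B" "card B = dim W"
    using basis_exists by blast
  then have finB: "finite B" using independent_span_bound[OF fin(3) B(2)] fin by blast
  have "card (A \<times> B) < card I" using less A B by (simp add: card_cartesian_product)
  then obtain c where c: "\<exists>i\<in>I. c i \<noteq> 0"
    and sys: "\<And>a b. a \<in> A \<Longrightarrow> b \<in> B \<Longrightarrow> (\<Sum>i\<in>I. c i * representation B (f i a) b) = 0"
    using homogeneous_system_solvable[of "A \<times> B" I "\<lambda>i (a, b). representation B (f i a) b"]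
      finA finB I by auto
  define F where "F u = (\<Sum>i\<in>I. scale (c i) (f i u))" for u
  have F: "F a = 0" if "a \<in> A" for a
  proof -
    have "f i a \<in> span B" if "i \<in> I" for i
      using maps[OF that, of a] \<open>a \<in> A\<close> A(1) B(3) by blast
    then
    have "F a = (\<Sum>i\<in>I. scale (c i) (\<Sum>b\<in>B. scale (representation B (f i a) b) b))"
      unfolding F_def using B finB
      by (intro sum.cong refl arg_cong[of _ _ "scale _"] sum_representation_eq[symmetric]) auto
    also have "\<dots> = (\<Sum>b\<in>B. scale (\<Sum>i\<in>I. c i * representation B (f i a) b) b)"
      by (simp add: scale_sum_right scale_sum_left) (rule sum.swap)
    also have "\<dots> = 0" using sys that by simp
    finally show ?thesis .
  qed
  have lin_F: "F (a + scale r b) = F a + scale r (F b)" for a b r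
    unfolding F_def scale_sum_right sum.distrib[symmetric]
  proof (rule sum.cong)
    fix i assume "i \<in> I"
    then interpret l: Vector_Spaces.linear scale scale "f i" by (rule lin)
    show "scale (c i) (f i (a + scale r b)) = scale (c i) (f i a) + scale r (scale (c i) (f i b))"
      by (simp add: l.add l.scale scale_right_distrib mult.commute)
  qed simp
  have F0: "F 0 = 0" using lin_F[of 0 1 0] by simp
  have "F u = 0" if "u \<in> span A" for u
    using that
  proof (induction rule: span_induct_alt)
    case base then show ?case by (rule F0)
  next
    case (step r a v)
    then show ?case using lin_F[of v r a] F[of a] by (simp add: add.commute)
  qed
  then show False using indep[of c] c A(3) unfolding F_def by blast
qed

end

text \<open>The relations of the algebra after substituting \<open>p i = 1\<close>. The elements
  \<open>z i\<close> enter through their recursion, and \<open>z 0 = 0\<close> makes the relation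
  between \<open>x i\<close> and \<open>y i\<close> uniform in \<open>i\<close>.\<close>

locale kn_relations = kalgebra scale
  for scale :: "'k::field \<Rightarrow> 'a::ring_1 \<Rightarrow> 'a" +
  fixes n :: nat and q :: "nat \<Rightarrow> 'k" and \<gamma> :: "nat \<Rightarrow> nat \<Rightarrow> 'k" and x y z :: "nat \<Rightarrow> 'a"
  assumes q_nz: "i \<in> {1..n} \<Longrightarrow> q i \<noteq> 0"
    and q_not_root: "i \<in> {1..n} \<Longrightarrow> k \<ge> 1 \<Longrightarrow> q i ^ k \<noteq> 1"
    and \<gamma>_antisym: "i \<in> {1..n} \<Longrightarrow> j \<in> {1..n} \<Longrightarrow> \<gamma> i j * \<gamma> j i = 1"
    and rel_xx: "1 \<le> i \<Longrightarrow> i < j \<Longrightarrow> j \<le> n \<Longrightarrow> x i * x j = scale (q i * \<gamma> i j) (x j * x i)"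
    and rel_yy: "1 \<le> i \<Longrightarrow> i < j \<Longrightarrow> j \<le> n \<Longrightarrow> y i * y j = scale (\<gamma> i j) (y j * y i)"
    and rel_xy_less: "1 \<le> i \<Longrightarrow> i < j \<Longrightarrow> j \<le> n \<Longrightarrow> x i * y j = scale (inverse (\<gamma> i j)) (y j * x i)"
    and rel_xy_greater:
      "1 \<le> j \<Longrightarrow> j < i \<Longrightarrow> i \<le> n \<Longrightarrow> x i * y j = scale (q j * inverse (\<gamma> i j)) (y j * x i)"
    and rel_xy: "1 \<le> i \<Longrightarrow> i \<le> n \<Longrightarrow> x i * y i = scale (q i) (y i * x i) + z (i - 1)"
    and z_0: "z 0 = 0"
    and z_Suc: "z (Suc i) = z i + scale (q (Suc i) - 1) (y (Suc i) * x (Suc i))"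
begin

lemma q_neq_one: "i \<in> {1..n} \<Longrightarrow> q i \<noteq> 1"
  using q_not_root[of i 1] by simp

lemma \<gamma>_nz: "i \<in> {1..n} \<Longrightarrow> j \<in> {1..n} \<Longrightarrow> \<gamma> i j \<noteq> 0"
  using \<gamma>_antisym by force

lemma inverse_\<gamma>: "i \<in> {1..n} \<Longrightarrow> j \<in> {1..n} \<Longrightarrow> inverse (\<gamma> i j) = \<gamma> j i"
  using \<gamma>_antisym by (metis inverse_unique)

lemma z_pred:
  assumes "i \<in> {1..n}" shows "z i = z (i - 1) + scale (q i - 1) (y i * x i)"
  using assms z_Suc[of "i - 1"] by auto

section \<open>Commutation of the generators with the elements \<open>z i\<close>\<close>

lemma qcom_xx: "1 \<le> i \<Longrightarrow> i < j \<Longrightarrow> j \<le> n \<Longrightarrow> qcom (q i * \<gamma> i j) (x i) (x j)"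
  using rel_xx q_nz \<gamma>_nz by (auto simp: qcom_def)

lemma qcom_yy: "1 \<le> i \<Longrightarrow> i < j \<Longrightarrow> j \<le> n \<Longrightarrow> qcom (\<gamma> i j) (y i) (y j)"
  using rel_yy \<gamma>_nz by (auto simp: qcom_def)

lemma qcom_xy_less: "1 \<le> i \<Longrightarrow> i < j \<Longrightarrow> j \<le> n \<Longrightarrow> qcom (\<gamma> j i) (x i) (y j)"
  using rel_xy_less[of i j] \<gamma>_nz[of j i] inverse_\<gamma>[of i j] by (auto simp: qcom_def)

lemma qcom_xy_greater: "1 \<le> j \<Longrightarrow> j < i \<Longrightarrow> i \<le> n \<Longrightarrow> qcom (q j * \<gamma> j i) (x i) (y j)"
  using rel_xy_greater[of j i] q_nz \<gamma>_nz[of j i] inverse_\<gamma>[of i j] by (auto simp: qcom_def)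

text \<open>The factors \<open>\<gamma>\<close> arising from \<open>y l\<close> and from
  \<open>x l\<close> are inverse to each other. For \<open>l < j\<close> the factors
  \<open>q l\<close> cancel too, and for \<open>l > j\<close> a single \<open>q j\<close>
  remains.\<close>

lemma qcom_x_yx:
  assumes "j \<in> {1..n}" "l \<in> {1..n}" "l \<noteq> j"
  shows "qcom (if l < j then 1 else q j) (x j) (y l * x l)"
proof (cases "l < j")
  case True
  then have "qcom ((q l * \<gamma> l j) * inverse (q l * \<gamma> l j)) (x j) (y l * x l)"
    using assms by (intro qcom_mult_right qcom_xy_greater qcom_sym[OF qcom_xx]) auto
  moreover have "q l * \<gamma> l j \<noteq> 0" using assms q_nz \<gamma>_nz by simp
  ultimately show ?thesis using True by (simp del: inverse_mult_distrib)
next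
  case False
  then have "qcom (\<gamma> l j * (q j * \<gamma> j l)) (x j) (y l * x l)"
    using assms by (intro qcom_mult_right qcom_xy_less qcom_xx) auto
  then show ?thesis
    using assms False \<gamma>_antisym[of l j] by (simp add: mult.left_commute)
qed

lemma qcom_y_yx:
  assumes "j \<in> {1..n}" "l \<in> {1..n}" "l \<noteq> j"
  shows "qcom (if l < j then 1 else inverse (q j)) (y j) (y l * x l)"
proof (cases "l < j")
  case True
  then have "qcom (inverse (\<gamma> l j) * inverse (\<gamma> j l)) (y j) (y l * x l)"
    using assms by (intro qcom_mult_right qcom_sym[OF qcom_yy] qcom_sym[OF qcom_xy_less]) auto
  then show ?thesis
    using assms True \<gamma>_antisym[of l j] by (simp flip: inverse_mult_distrib)
next
  case False
  then have "qcom (\<gamma> j l * inverse (q j * \<gamma> j l)) (y j) (y l * x l)"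
    using assms by (intro qcom_mult_right qcom_yy qcom_sym[OF qcom_xy_greater]) auto
  then show ?thesis
    using assms False \<gamma>_nz[of j l] by (simp add: mult.left_commute[of "\<gamma> j l"])
qed

lemma qcom_xy_z_less:
  assumes "j \<in> {1..n}" "i < j"
  shows "qcom 1 (x j) (z i) \<and> qcom 1 (y j) (z i)"
  using assms(2)
proof (induction i)
  case 0
  then show ?case by (simp add: z_0 qcom_zero_right)
next
  case (Suc i)
  then have "qcom 1 (x j) (y (Suc i) * x (Suc i))" "qcom 1 (y j) (y (Suc i) * x (Suc i))"
    using assms qcom_x_yx[of j "Suc i"] qcom_y_yx[of j "Suc i"] by auto
  with Suc show ?case
    unfolding z_Suc by (auto intro!: qcom_add_right qcom_scale_right)
qed

text \<open>The product \<open>y j * x j\<close> alone does not commute with \<open>x j\<close> up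
  to a scalar: exchanging \<open>x j\<close> and \<open>y j\<close> leaves a term
  \<open>z (j - 1)\<close>. Together with the summand \<open>z (j - 1)\<close> of \<open>z j\<close>
  it gets the coefficient \<open>1 + (q j - 1) = q j\<close>, the same as the main term.\<close>

lemma qcom_xy_z_same:
  assumes j: "j \<in> {1..n}"
  shows "qcom (q j) (x j) (z j) \<and> qcom (inverse (q j)) (y j) (z j)"
proof
  let ?w = "z (j - 1)"
  have w: "x j * ?w = ?w * x j" "y j * ?w = ?w * y j"
    using qcom_xy_z_less[of j "j - 1"] j by (auto simp: qcom_def)
  have xy: "x j * y j = scale (q j) (y j * x j) + ?w" using rel_xy j by simp
  have "x j * z j = x j * ?w + scale (q j - 1) (x j * y j * x j)"
    unfolding z_pred[OF j] by (simp add: distrib_left scale_mult_right mult.assoc)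
  also have "\<dots> = scale 1 (?w * x j) + scale (q j - 1) (?w * x j)
      + scale (q j - 1) (scale (q j) (y j * x j * x j))"
    unfolding xy w by (simp add: distrib_right scale_right_distrib scale_mult_left)
  also have "scale 1 (?w * x j) + scale (q j - 1) (?w * x j) = scale (q j) (?w * x j)"
    unfolding scale_left_distrib[symmetric] by simp
  also have "scale (q j) (?w * x j) + scale (q j - 1) (scale (q j) (y j * x j * x j))
      = scale (q j) (z j * x j)"
    unfolding z_pred[OF j]
    by (simp add: distrib_right scale_right_distrib scale_mult_left mult.commute)
  finally show "qcom (q j) (x j) (z j)" using q_nz[OF j] by (simp add: qcom_def)
  have "z j * y j = ?w * y j + scale (q j - 1) (y j * (x j * y j))"
    unfolding z_pred[OF j] by (simp add: distrib_right scale_mult_left mult.assoc)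
  also have "\<dots> = scale 1 (y j * ?w) + scale (q j - 1) (y j * ?w)
      + scale (q j - 1) (scale (q j) (y j * (y j * x j)))"
    unfolding xy w(2)[symmetric] by (simp add: distrib_left scale_right_distrib scale_mult_right)
  also have "scale 1 (y j * ?w) + scale (q j - 1) (y j * ?w) = scale (q j) (y j * ?w)"
    unfolding scale_left_distrib[symmetric] by simp
  also have "scale (q j) (y j * ?w) + scale (q j - 1) (scale (q j) (y j * (y j * x j)))
      = scale (q j) (y j * z j)"
    unfolding z_pred[OF j]
    by (simp add: distrib_left scale_right_distrib scale_mult_right mult.commute)
  finally have "qcom (q j) (z j) (y j)" using q_nz[OF j] by (simp add: qcom_def)
  then show "qcom (inverse (q j)) (y j) (z j)" by (rule qcom_sym)
qed

text \<open>The summands of \<open>z i\<close> beyond index \<open>j\<close> have the same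
  commutation factor as \<open>z j\<close>, so they can be added one by one.\<close>

lemma qcom_xy_z_ge:
  assumes "j \<in> {1..n}" "j \<le> i" "i \<le> n"
  shows "qcom (q j) (x j) (z i) \<and> qcom (inverse (q j)) (y j) (z i)"
  using assms(2,3)
proof (induction i rule: dec_induct)
  case base
  then show ?case using qcom_xy_z_same[OF assms(1)] by simp
next
  case (step i)
  then have "qcom (q j) (x j) (y (Suc i) * x (Suc i))"
    "qcom (inverse (q j)) (y j) (y (Suc i) * x (Suc i))"
    using assms qcom_x_yx[of j "Suc i"] qcom_y_yx[of j "Suc i"] by auto
  with step show ?case
    unfolding z_Suc by (auto intro!: qcom_add_right qcom_scale_right)
qed

lemma qcom_x_z:
  assumes "j \<in> {1..n}" "i \<le> n" shows "qcom (if j \<le> i then q j else 1) (x j) (z i)"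
  using assms qcom_xy_z_less[of j i] qcom_xy_z_ge[of j i] by auto

lemma qcom_y_z:
  assumes "j \<in> {1..n}" "i \<le> n" shows "qcom (if j \<le> i then inverse (q j) else 1) (y j) (z i)"
  using assms qcom_xy_z_less[of j i] qcom_xy_z_ge[of j i] by auto

text \<open>The factors for passing \<open>y j\<close> and \<open>x j\<close> are mutually inverse,
  so here the elements commute exactly.\<close>

lemma qcom_z_yx:
  assumes "j \<in> {1..n}" "i \<le> n" shows "qcom 1 (z i) (y j * x j)"
proof -
  let ?c = "if j \<le> i then q j else 1"
  have "qcom (inverse (inverse ?c) * inverse ?c) (z i) (y j * x j)"
    using qcom_mult_right[OF qcom_sym[OF qcom_y_z[OF assms]] qcom_sym[OF qcom_x_z[OF assms]]]
    by (simp split: if_splits)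
  then show ?thesis using q_nz[OF assms(1)] by simp
qed

lemma qcom_z_z: "i \<le> n \<Longrightarrow> j \<le> n \<Longrightarrow> qcom 1 (z i) (z j)"
proof (induction j)
  case 0
  then show ?case by (simp add: z_0 qcom_zero_right)
next
  case (Suc j)
  then show ?case unfolding z_Suc by (auto intro!: qcom_add_right qcom_scale_right qcom_z_yx)
qed

lemma com_zz: "i \<le> n \<Longrightarrow> j \<le> n \<Longrightarrow> com (z i) (z j)"
  and com_xz: "j \<in> {1..n} \<Longrightarrow> i \<le> n \<Longrightarrow> com (x j) (z i)"
  and com_yz: "j \<in> {1..n} \<Longrightarrow> i \<le> n \<Longrightarrow> com (y j) (z i)"
  and com_zx: "j \<in> {1..n} \<Longrightarrow> i \<le> n \<Longrightarrow> com (z i) (x j)"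
  and com_zy: "j \<in> {1..n} \<Longrightarrow> i \<le> n \<Longrightarrow> com (z i) (y j)"
  unfolding com_def using qcom_z_z qcom_x_z qcom_y_z qcom_sym by metis+

lemma com_xx: "i \<in> {1..n} \<Longrightarrow> j \<in> {1..n} \<Longrightarrow> com (x i) (x j)"
  using qcom_xx[of i j] qcom_sym[OF qcom_xx[of j i]]
  by (cases i j rule: linorder_cases) (auto simp: com_def[abs_def] intro: com_refl[unfolded com_def])

lemma com_yy: "i \<in> {1..n} \<Longrightarrow> j \<in> {1..n} \<Longrightarrow> com (y i) (y j)"
  using qcom_yy[of i j] qcom_sym[OF qcom_yy[of j i]]
  by (cases i j rule: linorder_cases) (auto simp: com_def[abs_def] intro: com_refl[unfolded com_def])

lemma com_xy: "i \<in> {1..n} \<Longrightarrow> j \<in> {1..n} \<Longrightarrow> i \<noteq> j \<Longrightarrow> com (x i) (y j)"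
  unfolding com_def using qcom_xy_less[of i j] qcom_xy_greater[of j i]
  by (cases i j rule: linorder_cases) auto

lemma com_yx: "i \<in> {1..n} \<Longrightarrow> j \<in> {1..n} \<Longrightarrow> i \<noteq> j \<Longrightarrow> com (y i) (x j)"
  using com_xy com_sym by blast

text \<open>The recursion for \<open>z i\<close> is solved for \<open>y i * x i\<close>, which is
  possible because \<open>q i \<noteq> 1\<close>. Thus a product of \<open>x i\<close> and
  \<open>y i\<close> can always be traded for \<open>z i\<close> and
  \<open>z (i - 1)\<close>.\<close>

lemma yx_eq:
  assumes "i \<in> {1..n}"
  shows "y i * x i = scale (inverse (q i - 1)) (z i) + scale (- inverse (q i - 1)) (z (i - 1))"
  unfolding z_pred[OF assms] using q_neq_one[OF assms]
  by (simp add: scale_right_distrib)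

lemma xy_eq_yx: "i \<in> {1..n} \<Longrightarrow> x i * y i = y i * x i + z i"
  unfolding z_pred by (simp add: rel_xy algebra_simps scale_left_diff_distrib)

lemma xy_eq:
  assumes "i \<in> {1..n}"
  shows "x i * y i = scale (1 + inverse (q i - 1)) (z i) + scale (- inverse (q i - 1)) (z (i - 1))"
  unfolding xy_eq_yx[OF assms] yx_eq[OF assms] by (simp add: scale_left_distrib)

text \<open>Each exchange of \<open>x i\<close> and \<open>y i\<close> costs one \<open>z i\<close>,
  and carrying it left past the remaining powers of \<open>x i\<close> multiplies it by
  \<open>q i\<close>; the coefficient is the resulting q-integer. For \<open>k = 0\<close> this
  coefficient is an empty sum, so the truncated exponent \<open>k - 1\<close> is harmless.\<close>

lemma x_power_y:
  assumes i: "i \<in> {1..n}"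
  shows "x i ^ k * y i = y i * x i ^ k + scale (\<Sum>j<k. q i ^ j) (z i * x i ^ (k - 1))"
proof (induction k)
  case 0
  then show ?case by simp
next
  case (Suc k)
  have xz: "x i * z i = scale (q i) (z i * x i)"
    using qcom_x_z[of i i] i by (simp add: qcom_def)
  have "x i ^ Suc k * y i = x i * (x i ^ k * y i)" by (simp add: mult.assoc)
  also have "\<dots> = x i * y i * x i ^ k
      + scale (\<Sum>j<k. q i ^ j) (x i * z i * x i ^ (k - 1))"
    unfolding Suc by (simp add: distrib_left scale_mult_right mult.assoc)
  also have "scale (\<Sum>j<k. q i ^ j) (x i * z i * x i ^ (k - 1))
      = scale (q i * (\<Sum>j<k. q i ^ j)) (z i * x i ^ k)"
    unfolding xz by (cases k) (auto simp: scale_mult_left mult.assoc mult.commute)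
  also have "x i * y i * x i ^ k = y i * x i ^ Suc k + scale 1 (z i * x i ^ k)"
    unfolding xy_eq_yx[OF i] by (simp add: distrib_right mult.assoc)
  also have "y i * x i ^ Suc k + scale 1 (z i * x i ^ k)
      + scale (q i * (\<Sum>j<k. q i ^ j)) (z i * x i ^ k)
      = y i * x i ^ Suc k + scale (1 + q i * (\<Sum>j<k. q i ^ j)) (z i * x i ^ k)"
    by (simp add: scale_left_distrib add.assoc)
  also have "1 + q i * (\<Sum>j<k. q i ^ j) = (\<Sum>j<Suc k. q i ^ j)"
    by (simp add: sum_distrib_left sum.lessThan_Suc_shift del: sum.lessThan_Suc)
  finally show ?case by simp
qed

text \<open>Multiplied by \<open>q i - 1\<close> the geometric sum becomes
  \<open>q i ^ k - 1\<close>, which is not zero.\<close>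

lemma q_integer_nz:
  assumes "i \<in> {1..n}" "k \<ge> 1"
  shows "(\<Sum>j<k. q i ^ j) \<noteq> 0"
proof
  assume "(\<Sum>j<k. q i ^ j) = 0"
  then have "q i ^ k - 1 = 0"
    using power_diff_1_eq[of "q i" k] by simp
  then show False using q_not_root[OF assms] by simp
qed

subsection \<open>Monomials\<close>

definition zmon :: "(nat \<Rightarrow> nat) \<Rightarrow> 'a" where
  "zmon k = oprod n (\<lambda>i. z i ^ k i)"

definition xmon :: "(nat \<Rightarrow> nat) \<Rightarrow> 'a" where
  "xmon a = oprod n (\<lambda>i. x i ^ a i)"

definition mon :: "(nat \<Rightarrow> nat) \<times> (nat \<Rightarrow> nat) \<Rightarrow> 'a" where
  "mon ka = zmon (fst ka) * xmon (snd ka)"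

lemma com_y_zmon: "i \<in> {1..n} \<Longrightarrow> com (y i) (zmon k)"
  unfolding zmon_def by (intro com_oprod com_power_right com_yz) auto

lemma com_z_xmon: "i \<le> n \<Longrightarrow> com (z i) (xmon k)"
  unfolding xmon_def by (intro com_oprod com_power_right com_zx) auto

lemma zmon_mult_z:
  assumes "i \<in> {1..n}"
  shows "sim (zmon k * z i) (zmon (k(i := Suc (k i))))"
proof -
  have "sim (zmon k * z i) (oprod n ((\<lambda>j. z j ^ k j)(i := z i ^ k i * z i)))"
    unfolding zmon_def using assms by (intro oprod_mult_right com_power_right com_zz) auto
  also have "(\<lambda>j. z j ^ k j)(i := z i ^ k i * z i) = (\<lambda>j. z j ^ (k(i := Suc (k i))) j)"
    by (auto simp: power_commutes)
  finally show ?thesis unfolding zmon_def .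
qed

lemma xmon_mult_x:
  assumes "i \<in> {1..n}"
  shows "sim (xmon a * x i) (xmon (a(i := Suc (a i))))"
proof -
  have "sim (xmon a * x i) (oprod n ((\<lambda>j. x j ^ a j)(i := x i ^ a i * x i)))"
    unfolding xmon_def using assms by (intro oprod_mult_right com_power_right com_xx) auto
  also have "(\<lambda>j. x j ^ a j)(i := x i ^ a i * x i) = (\<lambda>j. x j ^ (a(i := Suc (a i))) j)"
    by (auto simp: power_commutes)
  finally show ?thesis unfolding xmon_def .
qed

lemma mon_mult_z:
  assumes "i \<in> {1..n}"
  shows "sim (mon (k, a) * z i) (mon (k(i := Suc (k i)), a))"
proof -
  have "sim (zmon k * (xmon a * z i)) (zmon k * (z i * xmon a))"
    using com_sym[OF com_z_xmon[of i a]] assms by (intro sim_mult[OF sim_refl]) (simp add: com_iff_sim)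
  also have "sim (zmon k * (z i * xmon a)) (zmon (k(i := Suc (k i))) * xmon a)"
    using sim_mult[OF zmon_mult_z[OF assms] sim_refl] by (simp add: mult.assoc)
  finally show ?thesis by (simp add: mon_def mult.assoc)
qed

lemma mon_mult_x:
  assumes "i \<in> {1..n}"
  shows "sim (mon (k, a) * x i) (mon (k, a(i := Suc (a i))))"
  using sim_mult[OF sim_refl xmon_mult_x[OF assms], of "zmon k"] by (simp add: mon_def mult.assoc)

lemma mon_mult_z_power:
  assumes "i \<in> {1..n}"
  shows "sim (mon (k, a) * z i ^ d) (mon (k(i := k i + d), a))"
proof (induction d)
  case (Suc d)
  have "sim (mon (k, a) * z i ^ d * z i) (mon (k(i := k i + d), a) * z i)"
    using Suc by (rule sim_mult) simp
  also have "sim \<dots> (mon (k(i := k i + Suc d), a))"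
    using mon_mult_z[OF assms, of "k(i := k i + d)" a] by (simp del: fun_upd_apply add: fun_upd_same)
  finally show ?case by (simp add: mult.assoc power_commutes del: fun_upd_apply)
qed simp

lemma mon_mult_x_power:
  assumes "i \<in> {1..n}"
  shows "sim (mon (k, a) * x i ^ d) (mon (k, a(i := a i + d)))"
proof (induction d)
  case (Suc d)
  have "sim (mon (k, a) * x i ^ d * x i) (mon (k, a(i := a i + d)) * x i)"
    using Suc by (rule sim_mult) simp
  also have "sim \<dots> (mon (k, a(i := a i + Suc d)))"
    using mon_mult_x[OF assms, of k "a(i := a i + d)"] by (simp del: fun_upd_apply add: fun_upd_same)
  finally show ?case by (simp add: mult.assoc power_commutes del: fun_upd_apply)
qed simp

text \<open>The scalars \<open>c\<close> and \<open>d\<close> compensate for moving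
  \<open>y i\<close> to the power of \<open>x i\<close> from the right and from the left. There the
  terms with \<open>y i\<close> in front cancel, and \<open>x_power_y\<close> leaves a multiple of
  \<open>z i * x i ^ (a i - 1)\<close>, nonzero since \<open>a i \<ge> 1\<close>. The new
  \<open>z i\<close> is then moved into \<open>zmon k\<close>.\<close>

lemma mon_commutator_y:
  assumes i: "i \<in> {1..n}" and a: "a i \<ge> 1"
  obtains c d where "c \<noteq> 0" "d \<noteq> 0"
    "sim (scale c (mon (k, a) * y i) - scale d (y i * mon (k, a))) (mon (k(i := Suc (k i)), a(i := a i - 1)))"
proof -
  let ?f = "\<lambda>j. x j ^ a j"
  have "sim (oprod n ?f * y i) (oprod n (?f(i := x i ^ a i * y i)))"
    using i com_power_right[OF com_yx] by (intro oprod_mult_right) auto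
  then have right: "sim (mon (k, a) * y i) (zmon k * oprod n (?f(i := x i ^ a i * y i)))"
    unfolding mon_def xmon_def by (simp add: mult.assoc sim_mult)
  have "sim (y i * zmon k * oprod n ?f) (zmon k * y i * oprod n ?f)"
    using com_y_zmon[OF i, of k] by (intro sim_mult[OF _ sim_refl]) (simp add: com_iff_sim)
  also have "sim \<dots> (zmon k * oprod n (?f(i := y i * x i ^ a i)))"
    unfolding mult.assoc using i com_power_right[OF com_yx]
    by (intro sim_mult[OF sim_refl] oprod_mult_left) auto
  finally have left: "sim (y i * mon (k, a)) (zmon k * oprod n (?f(i := y i * x i ^ a i)))"
    unfolding mon_def xmon_def by (simp add: mult.assoc)
  obtain c where c: "c \<noteq> 0"
    "zmon k * oprod n (?f(i := x i ^ a i * y i)) = scale c (mon (k, a) * y i)"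
    using sim_sym[OF right] by (auto simp: sim_def)
  obtain d where d: "d \<noteq> 0"
    "zmon k * oprod n (?f(i := y i * x i ^ a i)) = scale d (y i * mon (k, a))"
    using sim_sym[OF left] by (auto simp: sim_def)
  let ?e = "\<Sum>j<a i. q i ^ j"
  let ?g = "?f(i := x i ^ (a i - 1))"
  let ?T = "zmon k * oprod n (?f(i := z i * x i ^ (a i - 1)))"
  have eq: "scale c (mon (k, a) * y i) - scale d (y i * mon (k, a)) =
      scale ?e (zmon k * oprod n (?f(i := z i * x i ^ (a i - 1))))"
    unfolding c(2)[symmetric] d(2)[symmetric] x_power_y[OF i]
      oprod_update_add[OF i] oprod_update_scale[OF i]
    by (simp add: distrib_left scale_mult_right)
  have "sim (scale ?e ?T) ?T"
    using q_integer_nz[OF i a] by (auto simp: sim_def)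
  moreover have "sim ?T (mon (k(i := Suc (k i)), a(i := a i - 1)))"
  proof -
    have f: "?f(i := z i * x i ^ (a i - 1)) = ?g(i := z i * ?g i)" by simp
    have g: "oprod n ?g = xmon (a(i := a i - 1))"
      unfolding xmon_def by (rule oprod_cong) simp
    have "com (z i) (?g j)" if "j \<in> {1..n} - {i}" for j
      using that i by (auto intro!: com_power_right com_zx)
    then have "sim (oprod n (?g(i := z i * ?g i))) (z i * oprod n ?g)"
      by (rule sim_sym[OF oprod_mult_left[OF i]])
    then have "sim (zmon k * oprod n (?g(i := z i * ?g i))) (zmon k * (z i * oprod n ?g))"
      by (rule sim_mult[OF sim_refl])
    also have "\<dots> = zmon k * z i * xmon (a(i := a i - 1))"
      unfolding g by (simp add: mult.assoc)
    also have "sim \<dots> (zmon (k(i := Suc (k i))) * xmon (a(i := a i - 1)))"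
      by (rule sim_mult[OF zmon_mult_z[OF i] sim_refl])
    finally show ?thesis by (subst f) (simp only: mon_def fst_conv snd_conv)
  qed
  ultimately have "sim (scale ?e ?T) (mon (k(i := Suc (k i)), a(i := a i - 1)))"
    by (rule sim_trans)
  then show thesis unfolding eq[symmetric] by (rule that[OF c(1) d(1)])
qed

text \<open>The \<open>z j\<close> commute with \<open>z i\<close>, so the eigenvalue involves only
  the exponents of those \<open>x j\<close> with \<open>j \<le> i\<close>; this triangular shape
  lets them be determined one after another.\<close>

lemma qcom_z_mon:
  assumes "i \<in> {1..n}"
  shows "qcom (\<Prod>j\<in>{1..n}. if j \<le> i then inverse (q j) ^ a j else 1) (z i) (mon (k, a))"
proof -
  have "qcom (\<Prod>j\<in>{1..n}. 1) (z i) (zmon k)"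
    unfolding zmon_def using assms
    by (intro qcom_oprod) (use qcom_power_right[OF qcom_z_z] in fastforce)
  moreover have "qcom (\<Prod>j\<in>{1..n}. if j \<le> i then inverse (q j) ^ a j else 1) (z i) (xmon a)"
    unfolding xmon_def
  proof (intro qcom_oprod)
    fix j assume "j \<in> {1..n}"
    then have "qcom (inverse (if j \<le> i then q j else 1) ^ a j) (z i) (x j ^ a j)"
      using assms by (intro qcom_power_right qcom_sym[OF qcom_x_z]) auto
    then show "qcom (if j \<le> i then inverse (q j) ^ a j else 1) (z i) (x j ^ a j)"
      by (simp split: if_splits)
  qed
  ultimately show ?thesis
    unfolding mon_def fst_conv snd_conv using qcom_mult_right by fastforce
qed

text \<open>The constant \<open>c\<close> comes from passing \<open>xmon a\<close> and is chosen
  before \<open>k\<close>. Among monomials with equal \<open>a\<close> the eigenvalue therefore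
  depends only on the exponents of \<open>z j\<close> with \<open>j \<ge> i\<close>.\<close>

lemma qcom_x_mon:
  assumes "i \<in> {1..n}"
  obtains c where "\<And>k. qcom (c * (\<Prod>j\<in>{1..n}. if i \<le> j then q i ^ k j else 1)) (x i) (mon (k, a))"
proof -
  have "com (x i) (xmon a)"
    unfolding xmon_def using assms by (intro com_oprod com_power_right com_xx) auto
  then obtain c where "qcom c (x i) (xmon a)" by (auto simp: com_def)
  moreover have "qcom (\<Prod>j\<in>{1..n}. if i \<le> j then q i ^ k j else 1) (x i) (zmon k)" for k
    unfolding zmon_def
  proof (intro qcom_oprod)
    fix j assume "j \<in> {1..n}"
    then have "qcom ((if i \<le> j then q i else 1) ^ k j) (x i) (z j ^ k j)"
      using assms by (intro qcom_power_right qcom_x_z) auto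
    then show "qcom (if i \<le> j then q i ^ k j else 1) (x i) (z j ^ k j)"
      by (simp split: if_splits)
  qed
  ultimately have "qcom (c * (\<Prod>j\<in>{1..n}. if i \<le> j then q i ^ k j else 1)) (x i) (mon (k, a))" for k
    unfolding mon_def fst_conv snd_conv by (subst mult.commute) (rule qcom_mult_right)
  then show thesis using that by blast
qed

end

section \<open>Elimination by commutators\<close>

text \<open>The vector \<open>u\<close> is the witness that the module is not torsion; the elements
  \<open>zmon k\<close> will be identified with those of \<open>Kn_Zset\<close>.\<close>

locale kn_module = kn_relations scale n q \<gamma> x y z + right_module act
  for scale :: "'k::field \<Rightarrow> 'a::ring_1 \<Rightarrow> 'a" and n q \<gamma> x y z
    and act :: "'m::ab_group_add \<Rightarrow> 'a \<Rightarrow> 'm" +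
  fixes u :: 'm
  assumes nontorsion: "act u (zmon k) \<noteq> 0"
begin

lemma act_zero_right [simp]: "act v 0 = 0"
  using act_add_right[of v 0 0] by simp

lemma act_zero_left [simp]: "act 0 a = 0"
  using act_add_left[of 0 0 a] by simp

text \<open>The \<open>z i\<close>, although quadratic in the \<open>x i\<close> and
  \<open>y i\<close>, count as generators, so that a commutator with one of them costs a single
  filtration step.\<close>

definition gens :: "'a set" where
  "gens = x ` {1..n} \<union> y ` {1..n} \<union> z ` {1..n}"

text \<open>This is the annihilator of the \<open>M\<close>-th filtration step of the submodule
  generated by \<open>u\<close>. It is a right ideal that shrinks as \<open>M\<close> grows.\<close>

definition ann :: "nat \<Rightarrow> 'a set" where
  "ann M = {a. \<forall>vs. set vs \<subseteq> gens \<and> length vs \<le> M \<longrightarrow> act u (prod_list vs * a) = 0}"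

lemma annD: "a \<in> ann M \<Longrightarrow> set vs \<subseteq> gens \<Longrightarrow> length vs \<le> M \<Longrightarrow> act u (prod_list vs * a) = 0"
  by (simp add: ann_def)

lemma ann_zero: "0 \<in> ann M"
  by (simp add: ann_def)

lemma ann_add: "a \<in> ann M \<Longrightarrow> b \<in> ann M \<Longrightarrow> a + b \<in> ann M"
  by (simp add: ann_def distrib_left act_add_right)

lemma ann_mult_right: "a \<in> ann M \<Longrightarrow> a * b \<in> ann M"
  by (simp add: ann_def mult.assoc[symmetric] act_mult)

lemma ann_scale: "a \<in> ann M \<Longrightarrow> scale c a \<in> ann M"
  using ann_mult_right[of a M "scale c 1"] by (simp add: scale_mult_right)

lemma ann_diff: "a \<in> ann M \<Longrightarrow> b \<in> ann M \<Longrightarrow> a - b \<in> ann M"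
  using ann_add[of a M "scale (-1) b"] ann_scale[of b M "-1"] by simp

lemma ann_mono: "M \<le> N \<Longrightarrow> a \<in> ann N \<Longrightarrow> a \<in> ann M"
  by (auto simp: ann_def)

text \<open>The factor \<open>g\<close> is absorbed as the last letter of the word in front, which
  becomes one letter longer.\<close>

lemma ann_mult_left:
  assumes "a \<in> ann (Suc M)" "g \<in> gens" shows "g * a \<in> ann M"
  unfolding ann_def
proof (intro CollectI allI impI)
  fix vs assume "set vs \<subseteq> gens \<and> length vs \<le> M"
  then have "act u (prod_list (vs @ [g]) * a) = 0"
    using assms by (intro annD[of a "Suc M"]) auto
  then show "act u (prod_list vs * (g * a)) = 0" by (simp add: mult.assoc)
qed

lemma ann_sim: "sim a b \<Longrightarrow> a \<in> ann M \<Longrightarrow> b \<in> ann M"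
  using sim_sym ann_scale by (metis sim_def)

lemma zmon_notin_ann: "zmon k \<notin> ann M"
proof
  assume "zmon k \<in> ann M"
  then have "act u (prod_list [] * zmon k) = 0"
    by (rule annD) auto
  then show False using nontorsion by simp
qed

text \<open>Each commutator \<open>g a - r a g\<close> kills the component of eigenvalue \<open>r\<close> and costs one step
  of the filtration.\<close>

lemma ann_eliminate:
  assumes "finite R" and g: "g \<in> gens" and eig: "\<And>i. i \<in> I \<Longrightarrow> qcom (l i) g (m i)"
    and "(\<Sum>i\<in>I. scale (c i) (m i)) \<in> ann (M + card R)"
  shows "(\<Sum>i\<in>I. scale (c i * (\<Prod>r\<in>R. l i - r)) (m i * g ^ card R)) \<in> ann M"
  using assms(1,4)
proof (induction R arbitrary: M rule: finite_induct)
  case empty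
  then show ?case by simp
next
  case (insert r R)
  let ?d = "\<lambda>i. c i * (\<Prod>r\<in>R. l i - r)"
  define s where "s = (\<Sum>i\<in>I. scale (?d i) (m i * g ^ card R))"
  have s: "s \<in> ann (Suc M)"
    unfolding s_def using insert by (intro insert.IH) auto
  then have "g * s - scale r (s * g) \<in> ann M"
    using g by (intro ann_diff ann_mult_left ann_scale ann_mult_right ann_mono[of M "Suc M"]) auto
  also have "g * s - scale r (s * g)
      = (\<Sum>i\<in>I. scale (?d i) (g * m i * g ^ card R) - scale (r * ?d i) (m i * g ^ Suc (card R)))"
    unfolding s_def sum_distrib_left sum_distrib_right sum_subtractf scale_sum_right
    by (simp add: scale_mult_left scale_mult_right mult.assoc power_commutes)
  also have "\<dots> = (\<Sum>i\<in>I. scale (c i * (\<Prod>r\<in>insert r R. l i - r)) (m i * g ^ card (insert r R)))"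
  proof (rule sum.cong)
    fix i assume "i \<in> I"
    then have "g * m i * g ^ card R = scale (l i) (m i * g ^ Suc (card R))"
      using eig by (simp add: qcom_def scale_mult_left mult.assoc)
    moreover have "c i * (\<Prod>r\<in>insert r R. l i - r) = ?d i * l i - r * ?d i"
      using insert by (simp add: algebra_simps)
    ultimately show "scale (?d i) (g * m i * g ^ card R) - scale (r * ?d i) (m i * g ^ Suc (card R))
        = scale (c i * (\<Prod>r\<in>insert r R. l i - r)) (m i * g ^ card (insert r R))"
      using insert by (simp add: scale_left_diff_distrib)
  qed simp
  finally show ?case .
qed

text \<open>Since \<open>\<theta>\<close> is not a root of unity, different exponents have different
  eigenvalues. Eliminating every eigenvalue except that of \<open>v\<close> leaves the wanted
  component times one common nonzero scalar \<open>p\<close>.\<close>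

lemma ann_component:
  assumes fin: "finite I" and g: "g \<in> gens" and \<theta>: "\<theta> \<noteq> 0" "\<And>k. k \<ge> 1 \<Longrightarrow> \<theta> ^ k \<noteq> 1"
    and \<rho>: "\<rho> \<noteq> 0"
    and eig: "\<And>i. i \<in> I \<Longrightarrow> qcom (\<rho> * \<theta> ^ \<kappa> i) g (m i)"
    and bound: "\<And>i. i \<in> I \<Longrightarrow> \<kappa> i \<le> D" and v: "v \<le> D"
    and sum: "(\<Sum>i\<in>I. scale (c i) (m i)) \<in> ann (M + D)"
  shows "(\<Sum>i\<in>{i \<in> I. \<kappa> i = v}. scale (c i) (m i * g ^ D)) \<in> ann M"
proof -
  have inj_aux: "\<theta> ^ j \<noteq> \<theta> ^ k" if "j < k" for j k :: nat
  proof
    assume "\<theta> ^ j = \<theta> ^ k"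
    also have "\<theta> ^ k = \<theta> ^ j * \<theta> ^ (k - j)" using that by (simp flip: power_add)
    finally show False using \<theta>(1) \<theta>(2)[of "k - j"] that by simp
  qed
  have inj: "\<rho> * \<theta> ^ j = \<rho> * \<theta> ^ k \<longleftrightarrow> j = k" for j k
    using \<rho> inj_aux[of j k] inj_aux[of k j] by (cases j k rule: linorder_cases) auto
  \<comment> \<open>Values of the exponent that do not occur are included as well, so that exactly
    \<open>D\<close> steps are used and the power of \<open>g\<close> is always
    \<open>D\<close>.\<close>
  define R where "R = (\<lambda>k. \<rho> * \<theta> ^ k) ` ({..D} - {v})"
  have card: "card R = D"
    unfolding R_def using v by (subst card_image) (auto simp: inj_on_def inj simp del: mult_cancel_left)
  have fR: "finite R" by (simp add: R_def)
  define P where "P i = (\<Prod>r\<in>R. \<rho> * \<theta> ^ \<kappa> i - r)" for i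
  have P0: "P i = 0" if "i \<in> I" "\<kappa> i \<noteq> v" for i
    unfolding P_def using that bound[of i] fR by (simp add: R_def) auto
  define p where "p = (\<Prod>r\<in>R. \<rho> * \<theta> ^ v - r)"
  have p: "p \<noteq> 0" unfolding p_def using fR by (auto simp: R_def inj simp del: mult_cancel_left)
  have "(\<Sum>i\<in>I. scale (c i * P i) (m i * g ^ D)) \<in> ann M"
    using ann_eliminate[where I = I and m = m and c = c and M = M, OF fR g eig] sum unfolding card P_def by simp
  also have "(\<Sum>i\<in>I. scale (c i * P i) (m i * g ^ D))
      = (\<Sum>i\<in>{i \<in> I. \<kappa> i = v}. scale (c i * P i) (m i * g ^ D))"
    using fin P0 by (intro sum.mono_neutral_right) auto
  also have "\<dots> = scale p (\<Sum>i\<in>{i \<in> I. \<kappa> i = v}. scale (c i) (m i * g ^ D))"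
    unfolding scale_sum_right by (intro sum.cong) (auto simp: P_def p_def mult.commute)
  finally have "scale (inverse p) (scale p (\<Sum>i\<in>{i \<in> I. \<kappa> i = v}. scale (c i) (m i * g ^ D))) \<in> ann M"
    by (rule ann_scale)
  then show ?thesis using p by simp
qed

text \<open>The elements \<open>g s\<close> are used one after another, each cutting the index set
  down to indices agreeing with \<open>i0\<close>. Hence the eigenvalue of \<open>g s\<close> needs
  the stated form only on indices that survived the earlier stages. As the \<open>g s\<close>
  commute up to scalars, the powers appended so far change an eigenvalue only by a common
  factor.\<close>

lemma ann_isolate:
  fixes g :: "nat \<Rightarrow> 'a" and \<kappa> :: "nat \<Rightarrow> 'i \<Rightarrow> nat" and \<theta> :: "nat \<Rightarrow> 'k"
  assumes fin: "finite I" and i0: "i0 \<in> I"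
    and g: "\<And>s. s < S \<Longrightarrow> g s \<in> gens" "\<And>s t. s < S \<Longrightarrow> t < S \<Longrightarrow> com (g s) (g t)"
    and \<theta>: "\<And>s. s < S \<Longrightarrow> \<theta> s \<noteq> 0" "\<And>s k. s < S \<Longrightarrow> k \<ge> 1 \<Longrightarrow> \<theta> s ^ k \<noteq> 1"
    and bound: "\<And>s i. s < S \<Longrightarrow> i \<in> I \<Longrightarrow> \<kappa> s i \<le> D"
    and eig: "\<And>s. s < S \<Longrightarrow>
      \<exists>\<rho>. \<forall>i\<in>I. (\<forall>t<s. \<kappa> t i = \<kappa> t i0) \<longrightarrow> qcom (\<rho> * \<theta> s ^ \<kappa> s i) (g s) (m i)"
    and sum: "(\<Sum>i\<in>I. scale (c i) (m i)) \<in> ann (M + S * D)"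
  shows "(\<Sum>i\<in>{i \<in> I. \<forall>t<S. \<kappa> t i = \<kappa> t i0}.
    scale (c i) (m i * prod_list (map (\<lambda>s. g s ^ D) [0..<S]))) \<in> ann M"
  using assms(3-)
proof (induction S arbitrary: M)
  case 0
  then show ?case by simp
next
  case (Suc S)
  let ?I = "{i \<in> I. \<forall>t<S. \<kappa> t i = \<kappa> t i0}"
  define e where "e = prod_list (map (\<lambda>s. g s ^ D) [0..<S])"
  \<comment> \<open>The induction hypothesis spends \<open>S * D\<close> filtration steps, and the
    remaining \<open>D\<close> are kept for \<open>g S\<close>.\<close>
  have "M + Suc S * D = (M + D) + S * D" by simp
  with Suc.prems have IH: "(\<Sum>i\<in>?I. scale (c i) (m i * e)) \<in> ann (M + D)"
    unfolding e_def by (intro Suc.IH) (auto simp: add.assoc simp del: ex_simps all_simps)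
  have "com (g S) e"
    unfolding e_def using Suc.prems(2) by (intro com_prod_list_right) (auto intro: com_power_right)
  then obtain d where d: "qcom d (g S) e" by (auto simp: com_def)
  obtain \<rho> where \<rho>: "\<And>i. i \<in> ?I \<Longrightarrow> qcom (\<rho> * \<theta> S ^ \<kappa> S i) (g S) (m i)"
    using Suc.prems(6)[of S] by auto
  \<comment> \<open>The index \<open>i0\<close> survives every stage, so it can certify that
    \<open>\<rho>\<close> is nonzero.\<close>
  have "qcom (\<rho> * \<theta> S ^ \<kappa> S i0) (g S) (m i0)" using \<rho> i0 by blast
  then have nz: "d * \<rho> \<noteq> 0" using d by (simp add: qcom_def)
  have "qcom (d * \<rho> * \<theta> S ^ \<kappa> S i) (g S) (m i * e)" if "i \<in> ?I" for i
    using qcom_mult_right[OF \<rho>[OF that] d] by (simp only: ac_simps)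
  then have "(\<Sum>i\<in>{i \<in> ?I. \<kappa> S i = \<kappa> S i0}. scale (c i) (m i * e * g S ^ D)) \<in> ann M"
    using fin i0 nz IH Suc.prems(1,3-5)
    by (intro ann_component[where \<theta> = "\<theta> S" and \<rho> = "d * \<rho>" and \<kappa> = "\<kappa> S"]) auto
  also have "{i \<in> ?I. \<kappa> S i = \<kappa> S i0} = {i \<in> I. \<forall>t<Suc S. \<kappa> t i = \<kappa> t i0}"
    by (auto simp: less_Suc_eq)
  finally show ?case by (simp add: e_def mult.assoc)
qed

text \<open>Induction on the total degree in the \<open>x i\<close>: a commutator with
  \<open>y i\<close> trades one \<open>x i\<close> for one \<open>z i\<close> and costs one
  filtration step. At degree zero only some \<open>zmon k\<close> is left, and this does not kill
  \<open>u\<close>.\<close>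

lemma mon_notin_ann: "mon (k, a) \<notin> ann (\<Sum>i\<in>{1..n}. a i)"
proof (induction "\<Sum>i\<in>{1..n}. a i" arbitrary: k a)
  case 0
  then have "xmon a = 1" unfolding xmon_def by (intro oprod_eq_one) auto
  then show ?case using zmon_notin_ann by (simp add: mon_def)
next
  case (Suc N)
  have "\<exists>i\<in>{1..n}. a i \<noteq> 0"
  proof (rule ccontr)
    assume "\<not> ?thesis"
    then have "(\<Sum>i\<in>{1..n}. a i) = 0" by simp
    then show False using Suc(2) by simp
  qed
  then obtain i where i: "i \<in> {1..n}" "a i \<noteq> 0" by blast
  let ?a = "a(i := a i - 1)"
  have N: "N = (\<Sum>j\<in>{1..n}. ?a j)"
  proof -
    have "(\<Sum>j\<in>{1..n}. a j) = a i + (\<Sum>j\<in>{1..n} - {i}. a j)"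
      "(\<Sum>j\<in>{1..n}. ?a j) = ?a i + (\<Sum>j\<in>{1..n} - {i}. ?a j)"
      using i by (simp_all add: sum.remove del: fun_upd_apply)
    moreover have "(\<Sum>j\<in>{1..n} - {i}. ?a j) = (\<Sum>j\<in>{1..n} - {i}. a j)"
      by (intro sum.cong) auto
    ultimately show ?thesis using Suc(2) i by simp
  qed
  show ?case
  proof
    assume "mon (k, a) \<in> ann (\<Sum>i\<in>{1..n}. a i)"
    then have mem: "mon (k, a) \<in> ann (Suc N)" using Suc(2) by simp
    obtain c d where "sim (scale c (mon (k, a) * y i) - scale d (y i * mon (k, a)))
        (mon (k(i := Suc (k i)), ?a))"
      using mon_commutator_y[OF i(1), of a] i(2) by (metis less_one not_less)
    moreover have "scale c (mon (k, a) * y i) - scale d (y i * mon (k, a)) \<in> ann N"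
      using mem i
      by (intro ann_diff ann_scale ann_mult_left ann_mult_right ann_mono[of N "Suc N"]) (auto simp: gens_def)
    ultimately have "mon (k(i := Suc (k i)), ?a) \<in> ann N" by (rule ann_sim)
    then show False unfolding N using Suc(1)[OF N] by blast
  qed
qed

text \<open>Extensional functions are used so that exponent vectors are determined by their values
  on \<open>{1..n}\<close> and the box is finite.\<close>

definition box :: "nat \<Rightarrow> ((nat \<Rightarrow> nat) \<times> (nat \<Rightarrow> nat)) set" where
  "box D = ({1..n} \<rightarrow>\<^sub>E {..D}) \<times> ({1..n} \<rightarrow>\<^sub>E {..D})"

lemma finite_box: "finite (box D)"
  by (simp add: box_def finite_PiE)

lemma card_box: "card (box D) = (D + 1) ^ (2 * n)"
  by (simp add: box_def card_cartesian_product card_PiE mult_2 flip: power_add)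

text \<open>The eigenvalues of \<open>z 1, \<dots>, z n\<close> determine the exponents of the \<open>x i\<close> in increasing order;
  once these are fixed, those of \<open>x n, \<dots>, x 1\<close> determine the exponents of the \<open>z i\<close> in
  decreasing order.\<close>

definition eliminator :: "nat \<Rightarrow> 'a" where
  "eliminator s = (if s < n then z (Suc s) else x (2 * n - s))"

text \<open>The appended powers merely raise exponents, up to a scalar. The degree in the
  \<open>x i\<close> is recorded because it is the number of steps that \<open>mon_notin_ann\<close>
  requires.\<close>

lemma mon_mult_eliminators:
  assumes "S \<le> 2 * n"
  shows "\<exists>k' a'. sim (mon (k, a) * prod_list (map (\<lambda>s. eliminator s ^ D) [0..<S])) (mon (k', a'))
    \<and> (\<Sum>i\<in>{1..n}. a' i) \<le> (\<Sum>i\<in>{1..n}. a i) + S * D"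
  using assms
proof (induction S)
  case 0
  then show ?case using sim_refl by (intro exI[of _ k] exI[of _ a]) simp
next
  case (Suc S)
  then obtain k' a' where IH: "sim (mon (k, a) * prod_list (map (\<lambda>s. eliminator s ^ D) [0..<S])) (mon (k', a'))"
    "(\<Sum>i\<in>{1..n}. a' i) \<le> (\<Sum>i\<in>{1..n}. a i) + S * D"
    by auto
  have step: "sim (mon (k, a) * prod_list (map (\<lambda>s. eliminator s ^ D) [0..<Suc S]))
      (mon (k', a') * eliminator S ^ D)"
    using sim_mult[OF IH(1) sim_refl, of "eliminator S ^ D"] by (simp add: mult.assoc)
  show ?case
  proof (cases "S < n")
    case True
    then have "sim (mon (k', a') * eliminator S ^ D) (mon (k'(Suc S := k' (Suc S) + D), a'))"
      unfolding eliminator_def using mon_mult_z_power[of "Suc S"] by simp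
    then show ?thesis using sim_trans[OF step] IH(2) by fastforce
  next
    case False
    define i where "i = 2 * n - S"
    have i: "i \<in> {1..n}" using False Suc.prems by (auto simp: i_def)
    let ?a = "a'(i := a' i + D)"
    have "sim (mon (k', a') * eliminator S ^ D) (mon (k', ?a))"
      unfolding eliminator_def using False mon_mult_x_power[OF i] by (simp add: i_def)
    then have "sim (mon (k, a) * prod_list (map (\<lambda>s. eliminator s ^ D) [0..<Suc S])) (mon (k', ?a))"
      by (rule sim_trans[OF step])
    moreover have "(\<Sum>j\<in>{1..n}. ?a j) = (\<Sum>j\<in>{1..n}. a' j) + D"
    proof -
      have "(\<Sum>j\<in>{1..n}. ?a j) = (\<Sum>j\<in>{1..n}. a' j + (if i = j then D else 0))"
        by (intro sum.cong) auto
      then show ?thesis using i by (simp add: sum.distrib)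
    qed
    ultimately show ?thesis using IH(2) by (intro exI[of _ k'] exI[of _ ?a]) (simp del: fun_upd_apply upt_Suc)
  qed
qed

text \<open>Of the \<open>5 * n * D\<close> filtration steps, \<open>2 * n * D\<close> are spent on
  the \<open>2 * n\<close> eliminators. The isolated monomial times the eliminator powers has degree
  at most \<open>n * D + 2 * n * D\<close> in the \<open>x i\<close>, so the remaining
  \<open>3 * n * D\<close> steps suffice to contradict \<open>mon_notin_ann\<close>.\<close>

theorem mon_independent_mod_ann:
  assumes sum: "(\<Sum>ka\<in>box D. scale (c ka) (mon ka)) \<in> ann (5 * n * D)" and i0: "i0 \<in> box D"
  shows "c i0 = 0"
proof (rule ccontr)
  assume c: "c i0 \<noteq> 0"
  obtain k0 a0 where k0a0: "i0 = (k0, a0)" by (cases i0)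
  \<comment> \<open>\<open>\<kappa> s\<close> is the exponent that \<open>eliminator s\<close> reads
    off and \<open>\<theta> s\<close> the base of its eigenvalue: \<open>z i\<close> sees the
    exponent of \<open>x i\<close> through \<open>inverse (q i)\<close>, and \<open>x i\<close> sees
    that of \<open>z i\<close> through \<open>q i\<close>.\<close>
  define \<kappa> where "\<kappa> s ka = (if s < n then snd ka (Suc s) else fst ka (2 * n - s))"
    for s and ka :: "(nat \<Rightarrow> nat) \<times> (nat \<Rightarrow> nat)"
  define \<theta> where "\<theta> s = (if s < n then inverse (q (Suc s)) else q (2 * n - s))" for s
  have range: "2 * n - s \<in> {1..n}" if "s < 2 * n" "\<not> s < n" for s using that by auto
  have q_inv: "inverse (q i) \<noteq> 0" "inverse (q i) ^ k \<noteq> 1" if "i \<in> {1..n}" "k \<ge> 1" for i k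
    using q_nz[OF that(1)] q_not_root[OF that] by (simp_all add: power_inverse)
  have gens: "eliminator s \<in> gens" if "s < 2 * n" for s
    using range[OF that] by (auto simp: eliminator_def gens_def)
  have coms: "com (eliminator s) (eliminator t)" if "s < 2 * n" "t < 2 * n" for s t
    using range[of s] range[of t] that
    by (auto simp: eliminator_def intro: com_zz com_xx com_zx com_xz)
  \<comment> \<open>All other exponents entering the eigenvalue were fixed at earlier stages, so
    their contribution is the constant \<open>\<rho>\<close>.\<close>
  have eig: "\<exists>\<rho>. \<forall>ka\<in>box D. (\<forall>t<s. \<kappa> t ka = \<kappa> t i0) \<longrightarrow>
      qcom (\<rho> * \<theta> s ^ \<kappa> s ka) (eliminator s) (mon ka)" if s: "s < 2 * n" for s
  proof (cases "s < n")
    case True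
    define i where "i = Suc s"
    have i: "i \<in> {1..n}" using True by (simp add: i_def)
    let ?\<rho> = "\<Prod>j\<in>{1..n} - {i}. if j < i then inverse (q j) ^ a0 j else 1"
    have "qcom (?\<rho> * \<theta> s ^ \<kappa> s (k, a)) (eliminator s) (mon (k, a))"
      if eq: "\<forall>t<s. \<kappa> t (k, a) = \<kappa> t i0" for k a
    proof -
      have a: "a j = a0 j" if "j \<in> {1..n}" "j < i" for j
        using eq[rule_format, of "j - 1"] that True by (auto simp: \<kappa>_def k0a0 i_def)
      have "(\<Prod>j\<in>{1..n}. if j \<le> i then inverse (q j) ^ a j else 1) =
          inverse (q i) ^ a i * (\<Prod>j\<in>{1..n} - {i}. if j \<le> i then inverse (q j) ^ a j else 1)"
        using i by (simp add: prod.remove)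
      also have "(\<Prod>j\<in>{1..n} - {i}. if j \<le> i then inverse (q j) ^ a j else 1) = ?\<rho>"
        by (intro prod.cong) (auto simp: a)
      finally show ?thesis
        using qcom_z_mon[OF i, of a k] True by (simp add: \<theta>_def \<kappa>_def i_def eliminator_def mult.commute)
    qed
    then show ?thesis by (intro exI[of _ ?\<rho>]) auto
  next
    case False
    define i where "i = 2 * n - s"
    have i: "i \<in> {1..n}" using False s by (auto simp: i_def)
    \<comment> \<open>The constant \<open>d\<close> belongs to the exponents \<open>a0\<close>; it
      serves all surviving monomials because the first \<open>n\<close> stages have already forced
      \<open>a = a0\<close>.\<close>
    obtain d where d: "\<And>k. qcom (d * (\<Prod>j\<in>{1..n}. if i \<le> j then q i ^ k j else 1)) (x i) (mon (k, a0))"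
      using qcom_x_mon[OF i] by blast
    let ?\<rho> = "d * (\<Prod>j\<in>{1..n} - {i}. if i < j then q i ^ k0 j else 1)"
    have "qcom (?\<rho> * \<theta> s ^ \<kappa> s (k, a)) (eliminator s) (mon (k, a))"
      if eq: "\<forall>t<s. \<kappa> t (k, a) = \<kappa> t i0" and mem: "(k, a) \<in> box D" for k a
    proof -
      have a: "a = a0"
      proof (rule PiE_ext[of _ "{1..n}" "\<lambda>_. {..D}"])
        show "a j = a0 j" if "j \<in> {1..n}" for j
        proof -
          have "j - 1 < n" "Suc (j - 1) = j" "j - 1 < s" using that False by auto
          then show ?thesis using eq[rule_format, of "j - 1"] by (simp add: \<kappa>_def k0a0)
        qed
      qed (use mem assms k0a0 in \<open>auto simp: box_def\<close>)
      have k: "k j = k0 j" if "j \<in> {1..n}" "i < j" for j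
      proof -
        have "\<not> 2 * n - j < n" "2 * n - (2 * n - j) = j" "2 * n - j < s"
          using that False s by (auto simp: i_def)
        then show ?thesis using eq[rule_format, of "2 * n - j"] by (simp add: \<kappa>_def k0a0)
      qed
      have "(\<Prod>j\<in>{1..n}. if i \<le> j then q i ^ k j else 1) =
          q i ^ k i * (\<Prod>j\<in>{1..n} - {i}. if i \<le> j then q i ^ k j else 1)"
        using i by (simp add: prod.remove)
      also have "(\<Prod>j\<in>{1..n} - {i}. if i \<le> j then q i ^ k j else 1)
          = (\<Prod>j\<in>{1..n} - {i}. if i < j then q i ^ k0 j else 1)"
        by (intro prod.cong) (auto simp: k)
      finally show ?thesis
        using d[of k] False unfolding a
        by (simp add: \<theta>_def \<kappa>_def i_def eliminator_def mult.commute mult.left_commute)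
    qed
    then show ?thesis by (intro exI[of _ ?\<rho>]) auto
  qed
  have bound: "\<kappa> s ka \<le> D" if "s < 2 * n" "ka \<in> box D" for s ka
    using range[of s] that by (auto simp: \<kappa>_def box_def Pi_iff PiE_iff)
  let ?e = "prod_list (map (\<lambda>s. eliminator s ^ D) [0..<2 * n])"
  have "(\<Sum>ka\<in>{ka \<in> box D. \<forall>t<2 * n. \<kappa> t ka = \<kappa> t i0}. scale (c ka) (mon ka * ?e)) \<in> ann (3 * n * D)"
  proof (rule ann_isolate[where \<theta> = \<theta>])
    show "\<theta> s \<noteq> 0" "1 \<le> k \<Longrightarrow> \<theta> s ^ k \<noteq> 1" if "s < 2 * n" for s k
      using range[of s] that q_inv q_nz q_not_root by (auto simp: \<theta>_def)
    show "(\<Sum>i\<in>box D. scale (c i) (mon i)) \<in> ann (3 * n * D + 2 * n * D)"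
      using sum by (simp add: algebra_simps)
  qed (use finite_box i0 gens coms bound eig in auto)
  also have "{ka \<in> box D. \<forall>t<2 * n. \<kappa> t ka = \<kappa> t i0} = {i0}"
  proof -
    have "k = k0 \<and> a = a0"
      if mem: "(k, a) \<in> box D" and eq: "\<forall>t<2 * n. \<kappa> t (k, a) = \<kappa> t i0" for k a
    proof
      show "k = k0"
      proof (rule PiE_ext[of _ "{1..n}" "\<lambda>_. {..D}"])
        show "k j = k0 j" if "j \<in> {1..n}" for j
        proof -
          have "\<not> 2 * n - j < n" "2 * n - (2 * n - j) = j" "2 * n - j < 2 * n" using that by auto
          then show ?thesis using eq[rule_format, of "2 * n - j"] by (simp add: \<kappa>_def k0a0)
        qed
      qed (use mem i0 k0a0 in \<open>auto simp: box_def\<close>)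
      show "a = a0"
      proof (rule PiE_ext[of _ "{1..n}" "\<lambda>_. {..D}"])
        show "a j = a0 j" if "j \<in> {1..n}" for j
        proof -
          have "j - 1 < n" "Suc (j - 1) = j" "j - 1 < 2 * n" using that by auto
          then show ?thesis using eq[rule_format, of "j - 1"] by (simp add: \<kappa>_def k0a0)
        qed
      qed (use mem i0 k0a0 in \<open>auto simp: box_def\<close>)
    qed
    then show ?thesis using i0 by (auto simp: k0a0)
  qed
  finally have "scale (c i0) (mon i0 * ?e) \<in> ann (3 * n * D)" by simp
  then have mem: "mon (k0, a0) * ?e \<in> ann (3 * n * D)"
    using c ann_scale[of "scale (c i0) (mon i0 * ?e)" _ "inverse (c i0)"] by (simp add: k0a0)
  obtain k' a' where ka': "sim (mon (k0, a0) * ?e) (mon (k', a'))"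
    "(\<Sum>i\<in>{1..n}. a' i) \<le> (\<Sum>i\<in>{1..n}. a0 i) + 2 * n * D"
    using mon_mult_eliminators[of "2 * n"] by blast
  have "(\<Sum>i\<in>{1..n}. a0 i) \<le> (\<Sum>i\<in>{1..n}. D)"
    using i0 by (intro sum_mono) (auto simp: k0a0 box_def)
  then have "(\<Sum>i\<in>{1..n}. a' i) \<le> 3 * n * D" using ka'(2) by simp
  then have "mon (k', a') \<in> ann (\<Sum>i\<in>{1..n}. a' i)"
    using ann_sim[OF ka'(1) mem] ann_mono by blast
  then show False using mon_notin_ann by blast
qed

end

section \<open>Growth exponents\<close>

text \<open>For \<open>m \<ge> 2\<close> the bound is at most \<open>((c + 1) * m) ^ N\<close>,
  whose logarithm to base \<open>m\<close> is \<open>g m\<close>, and this tends to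
  \<open>N\<close>.\<close>

lemma growth_exponent_le:
  fixes d :: "nat \<Rightarrow> nat"
  assumes bound: "\<And>m. d m \<le> (c * m + 1) ^ N"
  shows "growth_exponent d \<le> ereal (real N)"
proof -
  define g where "g m = real N * (ln (real (c + 1)) / ln (real m) + 1)" for m :: nat
  have "filterlim (\<lambda>m::nat. ln (real m)) at_top sequentially"
    by (rule filterlim_compose[OF ln_at_top filterlim_real_sequentially])
  then have "(\<lambda>m. ln (real (c + 1)) / ln (real m)) \<longlonglongrightarrow> 0"
    by (rule real_tendsto_divide_at_top[OF tendsto_const])
  then have "g \<longlonglongrightarrow> real N * (0 + 1)"
    unfolding g_def by (intro tendsto_intros)
  then have lim: "limsup (\<lambda>m. ereal (g m)) = ereal (real N)"
    by (intro lim_imp_Limsup) simp_all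
  have "(if d m = 0 then - \<infinity> else ereal (log (real m) (real (d m)))) \<le> ereal (g m)"
    if m: "m \<ge> 2" for m
  proof (cases "d m = 0")
    case False
    have "d m \<le> ((c + 1) * m) ^ N"
      using bound[of m] m by (intro order_trans[OF bound] power_mono) auto
    then have "real (d m) \<le> (real (c + 1) * real m) ^ N"
      by (metis of_nat_le_iff of_nat_mult of_nat_power)
    then have "ln (real (d m)) \<le> ln ((real (c + 1) * real m) ^ N)"
      using False by (subst ln_le_cancel_iff) auto
    also have "\<dots> = real N * (ln (real (c + 1)) + ln (real m))"
      using m by (subst ln_realpow) (auto simp: ln_mult)
    finally have "ln (real (d m)) / ln (real m)
        \<le> real N * (ln (real (c + 1)) + ln (real m)) / ln (real m)"
      using m by (intro divide_right_mono) auto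
    also have "\<dots> = g m" using m by (simp add: g_def field_simps)
    finally show ?thesis using False by (simp add: log_def)
  qed simp
  then have "growth_exponent d \<le> limsup (\<lambda>m. ereal (g m))"
    unfolding growth_exponent_def
    by (intro Limsup_mono eventually_sequentiallyI[of 2])
  then show ?thesis unfolding lim .
qed

text \<open>A bound along the multiples of \<open>c\<close> is enough, since an upper limit
  dominates that of any subsequence. Here \<open>g D\<close> is the logarithm of
  \<open>D ^ N\<close> to base \<open>c * D\<close>.\<close>

lemma growth_exponent_ge:
  fixes d :: "nat \<Rightarrow> nat"
  assumes c: "c \<ge> 1" and bound: "\<And>D. D ^ N \<le> d (c * D)"
  shows "ereal (real N) \<le> growth_exponent d"
proof -
  define g where "g D = real N * (1 - ln (real c) / ln (real (c * D)))" for D :: nat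
  let ?f = "\<lambda>m. if d m = 0 then - \<infinity> else ereal (log (real m) (real (d m)))"
  have mono: "strict_mono (\<lambda>D. c * D)" using c by (auto simp: strict_mono_def)
  have "filterlim (\<lambda>m::nat. ln (real m)) at_top sequentially"
    by (rule filterlim_compose[OF ln_at_top filterlim_real_sequentially])
  then have "filterlim (\<lambda>D::nat. ln (real (c * D))) at_top sequentially"
    using filterlim_compose filterlim_subseq[OF mono] by blast
  then have "(\<lambda>D. ln (real c) / ln (real (c * D))) \<longlonglongrightarrow> 0"
    by (rule real_tendsto_divide_at_top[OF tendsto_const])
  then have "g \<longlonglongrightarrow> real N * (1 - 0)"
    unfolding g_def by (intro tendsto_intros)
  then have lim: "limsup (\<lambda>m. ereal (g m)) = ereal (real N)"
    by (intro lim_imp_Limsup) simp_all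
  have "ereal (g D) \<le> ?f (c * D)" if D: "D \<ge> 2" for D
  proof -
    have cD: "1 < real c * real D"
      using c D mult_mono[of 1 "real c" 2 "real D"] by simp
    have pos: "0 < D ^ N" using D by simp
    then have nz: "d (c * D) \<noteq> 0" using bound[of D] by linarith
    have "real N * ln (real D) = ln (real (D ^ N))"
      using D by (simp add: ln_realpow)
    also have "\<dots> \<le> ln (real (d (c * D)))"
      using pos bound[of D] nz by (subst ln_le_cancel_iff) (auto simp del: of_nat_power)
    finally have "real N * ln (real D) / ln (real (c * D)) \<le> ln (real (d (c * D))) / ln (real (c * D))"
      using cD by (intro divide_right_mono) auto
    moreover have "g D = real N * ln (real D) / ln (real (c * D))"
    proof -
      have "ln (real (c * D)) = ln (real c) + ln (real D)" using c D by (simp add: ln_mult)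
      moreover have "ln (real (c * D)) > 0" using cD by simp
      ultimately show ?thesis by (simp add: g_def field_simps)
    qed
    ultimately show ?thesis using nz by (simp add: log_def)
  qed
  then have "limsup (\<lambda>D. ereal (g D)) \<le> limsup (?f \<circ> (\<lambda>D. c * D))"
    unfolding comp_def by (intro Limsup_mono eventually_sequentiallyI[of 2])
  also have "\<dots> \<le> limsup ?f" by (rule limsup_subseq_mono[OF mono])
  finally show ?thesis unfolding lim growth_exponent_def .
qed

section \<open>Power filtrations\<close>

context kalgebra
begin

lemma power_filtration_eq:
  "power_filtration scale V m = span {prod_list vs | vs. set vs \<subseteq> V \<and> length vs \<le> m}"
  by (simp add: power_filtration_def)

lemma prod_list_in_power_filtration:
  "set vs \<subseteq> V \<Longrightarrow> length vs \<le> m \<Longrightarrow> prod_list vs \<in> power_filtration scale V m"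
  unfolding power_filtration_eq by (intro span_base) auto

lemma subspace_power_filtration: "subspace (power_filtration scale V m)"
  unfolding power_filtration_eq by (rule subspace_span)

lemma power_filtration_mono: "m \<le> m' \<Longrightarrow> power_filtration scale V m \<subseteq> power_filtration scale V m'"
  unfolding power_filtration_eq by (intro span_mono) auto

lemma power_filtration_induct [consumes 1, case_names zero scale_add]:
  assumes "a \<in> power_filtration scale V m" and "P 0"
    and "\<And>c vs b. set vs \<subseteq> V \<Longrightarrow> length vs \<le> m \<Longrightarrow> P b \<Longrightarrow> P (scale c (prod_list vs) + b)"
  shows "P a"
  using assms(1) unfolding power_filtration_eq
  by (induction rule: span_induct_alt) (use assms(2,3) in auto)

lemma power_filtration_mult:
  assumes "a \<in> power_filtration scale V m" "set ws \<subseteq> V" "length ws \<le> l"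
  shows "a * prod_list ws \<in> power_filtration scale V (m + l)"
  using assms(1)
proof (induction rule: power_filtration_induct)
  case zero
  then show ?case using subspace_0[OF subspace_power_filtration] by simp
next
  case (scale_add c vs b)
  have "prod_list (vs @ ws) \<in> power_filtration scale V (m + l)"
    using scale_add assms by (intro prod_list_in_power_filtration) auto
  then have "scale c (prod_list vs * prod_list ws) + b * prod_list ws \<in> power_filtration scale V (m + l)"
    using scale_add.IH subspace_power_filtration by (auto intro!: subspace_add subspace_scale)
  then show ?case by (simp add: distrib_right scale_mult_left)
qed

end

context kn_relations
begin

section \<open>A spanning set\<close>

text \<open>One integer encodes a power of \<open>x i\<close> (nonnegative) or of \<open>y i\<close>
  (negative). Both never need to occur together, as their products reduce to \<open>z i\<close> and
  \<open>z (i - 1)\<close>.\<close>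

definition xy_power :: "nat \<Rightarrow> int \<Rightarrow> 'a" where
  "xy_power i a = (if a \<ge> 0 then x i ^ nat a else y i ^ nat (- a))"

definition wmon :: "(nat \<Rightarrow> int) \<Rightarrow> 'a" where
  "wmon \<alpha> = oprod n (\<lambda>i. xy_power i (\<alpha> i))"

definition monomials :: "nat \<Rightarrow> 'a set" where
  "monomials d = {zmon k * wmon \<alpha> | k \<alpha>. \<forall>i\<in>{1..n}. k i \<le> d \<and> \<bar>\<alpha> i\<bar> \<le> int d}"

lemma monomials_mono: "d \<le> d' \<Longrightarrow> monomials d \<subseteq> monomials d'"
  unfolding monomials_def by force

lemma monomials_bound: "finite (monomials d) \<and> card (monomials d) \<le> (2 * d + 1) ^ (2 * n)"
proof -
  let ?I = "({1..n} \<rightarrow>\<^sub>E {..d}) \<times> ({1..n} \<rightarrow>\<^sub>E {- int d..int d})"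
  have "monomials d \<subseteq> (\<lambda>(k, \<alpha>). zmon k * wmon \<alpha>) ` ?I"
  proof
    fix a assume "a \<in> monomials d"
    then obtain k \<alpha> where a: "a = zmon k * wmon \<alpha>"
      and le: "\<And>i. i \<in> {1..n} \<Longrightarrow> k i \<le> d \<and> \<bar>\<alpha> i\<bar> \<le> int d"
      by (auto simp: monomials_def)
    have "zmon k = zmon (restrict k {1..n})" "wmon \<alpha> = wmon (restrict \<alpha> {1..n})"
      unfolding zmon_def wmon_def by (auto intro!: oprod_cong)
    moreover have "(restrict k {1..n}, restrict \<alpha> {1..n}) \<in> ?I"
      using le by (force simp: PiE_iff)
    ultimately show "a \<in> (\<lambda>(k, \<alpha>). zmon k * wmon \<alpha>) ` ?I"
      unfolding a by (metis (mono_tags, lifting) case_prod_conv image_eqI)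
  qed
  moreover have fin: "finite ?I" by (intro finite_cartesian_product finite_PiE) auto
  ultimately have "finite (monomials d)" and card: "card (monomials d) \<le> card ?I"
    by (auto intro: finite_surj surj_card_le)
  note card
  also have "card ?I = (d + 1) ^ n * (2 * d + 1) ^ n"
  proof -
    have "card {- int d..int d} = 2 * d + 1"
      unfolding card_atLeastAtMost_int by linarith
    then show ?thesis by (simp add: card_cartesian_product card_PiE)
  qed
  also have "\<dots> \<le> (2 * d + 1) ^ n * (2 * d + 1) ^ n"
    by (intro mult_right_mono power_mono) auto
  also have "\<dots> = (2 * d + 1) ^ (2 * n)" by (simp add: mult_2 power_add)
  finally show ?thesis using \<open>finite (monomials d)\<close> by blast
qed

lemma com_z_xy_power: "i \<in> {1..n} \<Longrightarrow> l \<le> n \<Longrightarrow> com (z l) (xy_power i a)"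
  by (simp add: xy_power_def com_power_right com_zx com_zy)

lemma com_x_xy_power: "i \<in> {1..n} \<Longrightarrow> j \<in> {1..n} \<Longrightarrow> i \<noteq> j \<Longrightarrow> com (x j) (xy_power i a)"
  by (simp add: xy_power_def com_power_right com_xx com_xy)

lemma com_y_xy_power: "i \<in> {1..n} \<Longrightarrow> j \<in> {1..n} \<Longrightarrow> i \<noteq> j \<Longrightarrow> com (y j) (xy_power i a)"
  by (simp add: xy_power_def com_power_right com_yy com_yx)

lemma sim_in_span: "sim a b \<Longrightarrow> b \<in> span S \<Longrightarrow> a \<in> span S"
  by (auto simp: sim_def span_scale)

lemma wmon_update: "oprod n ((\<lambda>i. xy_power i (\<alpha> i))(j := xy_power j b)) = wmon (\<alpha>(j := b))"
  unfolding wmon_def by (rule oprod_cong) simp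

text \<open>The bounds are asymmetric because the lemma is applied after a generator has already
  changed \<open>\<alpha>\<close>, while \<open>k\<close> still has room for one more
  \<open>z l\<close>.\<close>

lemma monomial_mult_z:
  assumes "l \<le> n" and le: "\<And>i. i \<in> {1..n} \<Longrightarrow> k i \<le> d \<and> \<bar>\<alpha> i\<bar> \<le> int (Suc d)"
  shows "zmon k * (wmon \<alpha> * z l) \<in> span (monomials (Suc d))"
proof (cases "l = 0")
  case True
  then show ?thesis by (simp add: z_0 span_zero)
next
  case False
  then have l: "l \<in> {1..n}" using assms by simp
  have "com (z l) (wmon \<alpha>)"
    unfolding wmon_def using l by (intro com_oprod com_z_xy_power) auto
  then have "sim (wmon \<alpha> * z l) (z l * wmon \<alpha>)" using com_sym com_iff_sim by blast
  then have "sim (zmon k * (wmon \<alpha> * z l)) (zmon k * (z l * wmon \<alpha>))" by (rule sim_mult[OF sim_refl])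
  moreover have "sim (zmon k * (z l * wmon \<alpha>)) (zmon (k(l := Suc (k l))) * wmon \<alpha>)"
    using sim_mult[OF zmon_mult_z[OF l] sim_refl] by (simp add: mult.assoc)
  moreover have "zmon (k(l := Suc (k l))) * wmon \<alpha> \<in> monomials (Suc d)"
    unfolding monomials_def using le by (fastforce intro: le_SucI)
  ultimately show ?thesis using sim_trans sim_in_span span_base by blast
qed

text \<open>Once \<open>g\<close> has been moved to position \<open>j\<close>, it either lengthens
  the power there or cancels an opposite generator. In the second case the resulting combination of
  \<open>z j\<close> and \<open>z (j - 1)\<close> is carried into the \<open>z\<close>-part.\<close>

lemma monomial_mult_gen:
  assumes j: "j \<in> {1..n}" and le: "\<And>i. i \<in> {1..n} \<Longrightarrow> k i \<le> d \<and> \<bar>\<alpha> i\<bar> \<le> int d"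
    and com: "\<And>i. i \<in> {1..n} - {j} \<Longrightarrow> com g (xy_power i (\<alpha> i))"
    and b: "\<bar>b\<bar> \<le> int (Suc d)"
    and g: "xy_power j (\<alpha> j) * g = xy_power j b \<or>
      xy_power j (\<alpha> j) * g = xy_power j b * (scale c (z j) + scale c' (z (j - 1)))"
  shows "zmon k * wmon \<alpha> * g \<in> span (monomials (Suc d))"
proof -
  let ?f = "\<lambda>i. xy_power i (\<alpha> i)"
  have "sim (zmon k * (wmon \<alpha> * g)) (zmon k * oprod n (?f(j := ?f j * g)))"
    unfolding wmon_def using com by (intro sim_mult[OF sim_refl] oprod_mult_right j) auto
  then have sim: "sim (zmon k * wmon \<alpha> * g) (zmon k * oprod n (?f(j := ?f j * g)))"
    by (simp add: mult.assoc)
  let ?\<alpha> = "\<alpha>(j := b)"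
  have le': "k i \<le> d \<and> \<bar>?\<alpha> i\<bar> \<le> int (Suc d)" if "i \<in> {1..n}" for i
    using le[OF that] b by auto
  have "zmon k * oprod n (?f(j := ?f j * g)) \<in> span (monomials (Suc d))"
    using g
  proof
    assume "?f j * g = xy_power j b"
    then have "zmon k * oprod n (?f(j := ?f j * g)) = zmon k * wmon ?\<alpha>"
      by (simp only: wmon_update)
    also have "\<dots> \<in> monomials (Suc d)"
      unfolding monomials_def using le' by (intro CollectI exI[of _ k] exI[of _ ?\<alpha>]) (auto intro: le_SucI)
    finally show ?thesis by (rule span_base)
  next
    assume eq: "?f j * g = xy_power j b * (scale c (z j) + scale c' (z (j - 1)))"
    have part: "zmon k * oprod n (?f(j := xy_power j b * z l)) \<in> span (monomials (Suc d))"
      if l: "l \<le> n" for l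
    proof -
      let ?h = "?f(j := xy_power j b)"
      have "com (z l) (?h i)" if "i \<in> {1..n} - {j}" for i
        using that l by (simp add: com_z_xy_power)
      then have "sim (oprod n ?h * z l) (oprod n (?h(j := ?h j * z l)))"
        by (rule oprod_mult_right[OF j])
      then have "sim (wmon ?\<alpha> * z l) (oprod n (?f(j := xy_power j b * z l)))"
        unfolding wmon_update by simp
      then have "sim (zmon k * oprod n (?f(j := xy_power j b * z l))) (zmon k * (wmon ?\<alpha> * z l))"
        by (intro sim_mult[OF sim_refl sim_sym])
      then show ?thesis
        using le' by (intro sim_in_span[OF _ monomial_mult_z[OF l]])
    qed
    have "zmon k * oprod n (?f(j := ?f j * g)) =
       scale c (zmon k * oprod n (?f(j := xy_power j b * z j))) +
       scale c' (zmon k * oprod n (?f(j := xy_power j b * z (j - 1))))"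
      unfolding eq
      by (simp only: distrib_left scale_mult_right oprod_update_add[OF j] oprod_update_scale[OF j])
    also have "\<dots> \<in> span (monomials (Suc d))"
      using j by (intro span_add span_scale part) auto
    finally show ?thesis .
  qed
  with sim show ?thesis by (rule sim_in_span)
qed

lemma xy_power_mult_x:
  assumes j: "j \<in> {1..n}" and a: "\<bar>a\<bar> \<le> int d"
  obtains b c c' where "\<bar>b\<bar> \<le> int (Suc d)"
    "xy_power j a * x j = xy_power j b \<or>
     xy_power j a * x j = xy_power j b * (scale c (z j) + scale c' (z (j - 1)))"
proof (cases "a \<ge> 0")
  case True
  then have "xy_power j a * x j = xy_power j (a + 1)"
    by (simp add: xy_power_def nat_add_distrib power_commutes)
  then show thesis using that[of "a + 1"] a by auto
next
  case False
  then have "nat (- a) = Suc (nat (- (a + 1)))" by simp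
  then have "xy_power j a = y j ^ nat (- (a + 1)) * y j"
    using False by (simp add: xy_power_def power_commutes)
  also have "y j ^ nat (- (a + 1)) = xy_power j (a + 1)"
    using False by (simp add: xy_power_def)
  finally have "xy_power j a * x j = xy_power j (a + 1) * (y j * x j)"
    by (simp add: mult.assoc)
  then show thesis using that[of "a + 1" "inverse (q j - 1)" "- inverse (q j - 1)"] a False
    unfolding yx_eq[OF j] by auto
qed

lemma xy_power_mult_y:
  assumes j: "j \<in> {1..n}" and a: "\<bar>a\<bar> \<le> int d"
  obtains b c c' where "\<bar>b\<bar> \<le> int (Suc d)"
    "xy_power j a * y j = xy_power j b \<or>
     xy_power j a * y j = xy_power j b * (scale c (z j) + scale c' (z (j - 1)))"
proof (cases "a > 0")
  case False
  then have "nat (- (a - 1)) = Suc (nat (- a))" by simp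
  then have "xy_power j a * y j = xy_power j (a - 1)"
    using False by (cases "a = 0") (simp_all add: xy_power_def power_commutes)
  then show thesis using that[of "a - 1"] a by auto
next
  case True
  then have "nat a = Suc (nat (a - 1))" by simp
  then have "xy_power j a = xy_power j (a - 1) * x j"
    using True by (simp add: xy_power_def power_commutes)
  then have "xy_power j a * y j = xy_power j (a - 1) * (x j * y j)"
    by (simp add: mult.assoc)
  then show thesis using that[of "a - 1" "1 + inverse (q j - 1)" "- inverse (q j - 1)"] a True
    unfolding xy_eq[OF j] by auto
qed

lemma span_monomials_mult_gen:
  assumes "a \<in> span (monomials d)" and g: "g \<in> x ` {1..n} \<union> y ` {1..n}"
  shows "a * g \<in> span (monomials (Suc d))"
  using assms(1)
proof (induction rule: span_induct_alt)
  case base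
  then show ?case by (simp add: span_zero)
next
  case (step c v b)
  from step(1) obtain k \<alpha> where v: "v = zmon k * wmon \<alpha>"
    and le: "\<And>i. i \<in> {1..n} \<Longrightarrow> k i \<le> d \<and> \<bar>\<alpha> i\<bar> \<le> int d"
    by (auto simp: monomials_def)
  have "v * g \<in> span (monomials (Suc d))"
    using g
  proof
    assume "g \<in> x ` {1..n}"
    then obtain j where j: "j \<in> {1..n}" "g = x j" by blast
    then have "\<bar>\<alpha> j\<bar> \<le> int d" using le by blast
    from xy_power_mult_x[OF j(1) this] obtain b c c' where "\<bar>b\<bar> \<le> int (Suc d)"
      "xy_power j (\<alpha> j) * g = xy_power j b \<or>
       xy_power j (\<alpha> j) * g = xy_power j b * (scale c (z j) + scale c' (z (j - 1)))" unfolding j(2) by blast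
    then show ?thesis
      unfolding v using j le com_x_xy_power by (intro monomial_mult_gen[of j]) auto
  next
    assume "g \<in> y ` {1..n}"
    then obtain j where j: "j \<in> {1..n}" "g = y j" by blast
    then have "\<bar>\<alpha> j\<bar> \<le> int d" using le by blast
    from xy_power_mult_y[OF j(1) this] obtain b c c' where "\<bar>b\<bar> \<le> int (Suc d)"
      "xy_power j (\<alpha> j) * g = xy_power j b \<or>
       xy_power j (\<alpha> j) * g = xy_power j b * (scale c (z j) + scale c' (z (j - 1)))" unfolding j(2) by blast
    then show ?thesis
      unfolding v using j le com_y_xy_power by (intro monomial_mult_gen[of j]) auto
  qed
  then show ?case using step(2) by (simp add: distrib_right scale_mult_left span_add span_scale)
qed

lemma span_monomials_mult_word:
  assumes "a \<in> span (monomials d)" and "set vs \<subseteq> x ` {1..n} \<union> y ` {1..n}"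
  shows "a * prod_list vs \<in> span (monomials (d + length vs))"
  using assms
proof (induction vs arbitrary: a d)
  case (Cons v vs)
  then have "a * v * prod_list vs \<in> span (monomials (Suc d + length vs))"
    by (intro Cons.IH span_monomials_mult_gen) auto
  then show ?case by (simp add: mult.assoc)
qed simp

lemma span_monomials_mult:
  assumes "a \<in> span (monomials d)"
    and "b \<in> power_filtration scale (x ` {1..n} \<union> y ` {1..n}) l"
  shows "a * b \<in> span (monomials (d + l))"
  using assms(2)
proof (induction rule: power_filtration_induct)
  case zero
  then show ?case by (simp add: span_zero)
next
  case (scale_add c vs b)
  have "a * prod_list vs \<in> span (monomials (d + length vs))"
    using assms scale_add by (intro span_monomials_mult_word)
  also have "\<dots> \<subseteq> span (monomials (d + l))"
    using scale_add by (intro span_mono monomials_mono) auto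
  finally show ?case
    using scale_add by (simp add: distrib_left scale_mult_right span_add span_scale)
qed

lemma one_in_monomials: "1 \<in> monomials d"
proof -
  have "zmon (\<lambda>_. 0) = 1" "wmon (\<lambda>_. 0) = 1"
    unfolding zmon_def wmon_def xy_power_def by (auto intro: oprod_eq_one)
  then have "1 = zmon (\<lambda>_. 0) * wmon (\<lambda>_. 0)" by simp
  then show ?thesis unfolding monomials_def by (intro CollectI exI[of _ "\<lambda>_. 0"]) auto
qed

end

section \<open>Upper bound for the dimension of the algebra\<close>

locale kn_algebra = kn_relations +
  assumes generated: "\<exists>l. a \<in> power_filtration scale (x ` {1..n} \<union> y ` {1..n}) l"
begin

text \<open>A finite spanning set of \<open>V\<close> lies in words of some length \<open>l\<close>
  in the \<open>x i\<close> and \<open>y i\<close>, and multiplication by such a word raises the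
  exponent bound by at most \<open>l\<close>.\<close>

lemma power_filtration_subset_monomials:
  assumes "findim_subspace scale V"
  obtains l where "\<And>m. power_filtration scale V m \<subseteq> span (monomials (l * m))"
proof -
  let ?P = "power_filtration scale (x ` {1..n} \<union> y ` {1..n})"
  obtain B where B: "finite B" "V = span B" using assms by (auto simp: findim_subspace_def)
  obtain f where f: "\<And>b. b \<in> ?P (f b)" using generated by metis
  define l where "l = Max (insert 0 (f ` B))"
  have "b \<in> ?P l" if "b \<in> B" for b
    using f[of b] power_filtration_mono[of "f b" l] that B(1) by (auto simp: l_def)
  then have V: "V \<subseteq> ?P l" unfolding B(2) by (intro span_minimal subspace_power_filtration) auto
  have words: "prod_list vs \<in> span (monomials (l * length vs))" if "set vs \<subseteq> V" for vs
    using that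
  proof (induction vs rule: rev_induct)
    case Nil
    then show ?case by (simp add: span_base one_in_monomials)
  next
    case (snoc v vs)
    then have "prod_list vs * v \<in> span (monomials (l * length vs + l))"
      using V by (intro span_monomials_mult) auto
    then show ?case by (simp add: add.commute)
  qed
  have "power_filtration scale V m \<subseteq> span (monomials (l * m))" for m
    unfolding power_filtration_eq
  proof (intro span_minimal subspace_span subsetI)
    fix a assume "a \<in> {prod_list vs |vs. set vs \<subseteq> V \<and> length vs \<le> m}"
    then obtain vs where vs: "a = prod_list vs" "set vs \<subseteq> V" "length vs \<le> m" by blast
    then have "span (monomials (l * length vs)) \<subseteq> span (monomials (l * m))"
      by (intro span_mono monomials_mono) auto
    with words[of vs] vs show "a \<in> span (monomials (l * m))" by auto
  qed
  then show thesis using that by blast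
qed

lemma GKdim_algebra_le: "GKdim_algebra scale \<le> ereal (real (2 * n))"
  unfolding GKdim_algebra_def
proof (intro SUP_least)
  fix V assume "V \<in> Collect (findim_subspace scale)"
  then obtain l where l: "\<And>m. power_filtration scale V m \<subseteq> span (monomials (l * m))"
    using power_filtration_subset_monomials by blast
  have "dim (power_filtration scale V m) \<le> (2 * l * m + 1) ^ (2 * n)" for m
  proof -
    have "dim (power_filtration scale V m) \<le> card (monomials (l * m))"
      using l monomials_bound by (intro dim_le_card) auto
    also have "\<dots> \<le> (2 * (l * m) + 1) ^ (2 * n)" using monomials_bound by blast
    finally show ?thesis by (simp add: mult.assoc)
  qed
  then show "growth_exponent (\<lambda>m. dim (power_filtration scale V m)) \<le> ereal (real (2 * n))"
    by (rule growth_exponent_le)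
qed

end

section \<open>Lower bounds\<close>

locale kn_algebra_module = kn_algebra scale n q \<gamma> x y z + kn_module scale n q \<gamma> x y z act u
  for scale :: "'k::field \<Rightarrow> 'a::ring_1 \<Rightarrow> 'a" and n q \<gamma> x y z
    and act :: "'m::ab_group_add \<Rightarrow> 'a \<Rightarrow> 'm" and u +
  assumes n_pos: "n \<ge> 1"
begin

abbreviation filt :: "nat \<Rightarrow> 'a set" where
  "filt \<equiv> power_filtration scale (span gens)"

lemma findim_span_gens: "findim_subspace scale (span gens)"
  unfolding findim_subspace_def gens_def by (intro exI conjI) auto

lemma oprod_power_word:
  assumes "f ` {1..n} \<subseteq> gens" and "\<And>i. i \<in> {1..n} \<Longrightarrow> k i \<le> D"
  obtains ws where "oprod n (\<lambda>i. f i ^ k i) = prod_list ws" "set ws \<subseteq> gens" "length ws \<le> n * D"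
proof
  let ?ws = "concat (map (\<lambda>i. replicate (k i) (f i)) [1..<Suc n])"
  have concat: "prod_list (concat (map (\<lambda>i. replicate (k i) (f i)) js)) = prod_list (map (\<lambda>i. f i ^ k i) js)" for js
    by (induction js) auto
  then show "oprod n (\<lambda>i. f i ^ k i) = prod_list ?ws" unfolding oprod_def by simp
  show "set ?ws \<subseteq> gens" using assms(1) by (auto simp del: upt_Suc)
  have "length (concat (map (\<lambda>i. replicate (k i) (f i)) js)) \<le> length js * D" if "set js \<subseteq> {1..n}" for js
    using that by (induction js) (use assms(2) in \<open>auto intro!: add_mono\<close>)
  from this[of "[1..<Suc n]"] show "length ?ws \<le> n * D"
    by (simp add: atLeastLessThanSuc_atLeastAtMost del: upt_Suc)
qed

text \<open>The exponents of the \<open>z i\<close> and those of the \<open>x i\<close> contribute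
  at most \<open>n * D\<close> letters each.\<close>

lemma mon_word:
  assumes "ka \<in> box D"
  obtains ws where "mon ka = prod_list ws" "set ws \<subseteq> gens" "length ws \<le> 2 * n * D"
proof -
  obtain k a where ka: "ka = (k, a)" by (cases ka)
  then have le: "\<And>i. i \<in> {1..n} \<Longrightarrow> k i \<le> D" "\<And>i. i \<in> {1..n} \<Longrightarrow> a i \<le> D"
    using assms by (auto simp: box_def)
  have sub: "z ` {1..n} \<subseteq> gens" "x ` {1..n} \<subseteq> gens" by (auto simp: gens_def)
  obtain vs where vs: "zmon k = prod_list vs" "set vs \<subseteq> gens" "length vs \<le> n * D"
    unfolding zmon_def using oprod_power_word[of z k D] sub(1) le(1) by blast
  obtain ws where ws: "xmon a = prod_list ws" "set ws \<subseteq> gens" "length ws \<le> n * D"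
    unfolding xmon_def using oprod_power_word[of x a D] sub(2) le(2) by blast
  show thesis
    by (rule that[of "vs @ ws"]) (use vs ws in \<open>auto simp: mon_def ka\<close>)
qed

text \<open>A vanishing combination lies in every \<open>ann M\<close>, so independence modulo
  \<open>ann\<close> contains ordinary linear independence.\<close>

lemma mon_independent:
  assumes "(\<Sum>ka\<in>box D. scale (c ka) (mon ka)) = 0"
  shows "\<forall>ka\<in>box D. c ka = 0"
  using mon_independent_mod_ann[of c D] assms ann_zero by simp

lemma GKdim_algebra_ge: "ereal (real (2 * n)) \<le> GKdim_algebra scale"
proof -
  obtain l where l: "\<And>m. filt m \<subseteq> span (monomials (l * m))"
    using power_filtration_subset_monomials[OF findim_span_gens] by blast
  have "D ^ (2 * n) \<le> dim (filt (2 * n * D))" for D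
  proof -
    have "D ^ (2 * n) \<le> card (box D)"
      unfolding card_box by (intro power_mono) auto
    also have "\<dots> \<le> dim (filt (2 * n * D))"
    proof (rule card_le_dim[OF _ l finite_box])
      show "mon ka \<in> filt (2 * n * D)" if "ka \<in> box D" for ka
        using mon_word[OF that] span_superset[of gens]
        by (metis prod_list_in_power_filtration subset_trans)
    qed (use monomials_bound mon_independent in auto)
    finally show ?thesis .
  qed
  then have "ereal (real (2 * n)) \<le> growth_exponent (\<lambda>m. dim (filt m))"
    by (intro growth_exponent_ge[of "2 * n"]) (use n_pos in auto)
  also have "\<dots> \<le> GKdim_algebra scale"
    unfolding GKdim_algebra_def using findim_span_gens by (intro SUP_upper) auto
  finally show ?thesis .
qed

section \<open>Bernstein's inequality for the module\<close>

abbreviation mscale :: "'k \<Rightarrow> 'm \<Rightarrow> 'm" where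
  "mscale \<equiv> module_scale scale act"

sublocale mod: vector_space mscale
  by (rule vector_space_module_scale) unfold_locales

lemma mscale_act: "mscale c (act v a) = act v (scale c a)"
  by (simp add: module_scale_def scale_mult_right flip: act_mult)

lemma act_mscale: "act (mscale c v) a = mscale c (act v a)"
  unfolding mscale_act by (simp add: module_scale_def scale_mult_left flip: act_mult)

lemma act_sum_right: "act v (sum f I) = (\<Sum>i\<in>I. act v (f i))"
  by (induction I rule: infinite_finite_induct) (auto simp: act_add_right)

text \<open>This has the shape of the spaces in \<open>GKdim_module\<close>, with the line through
  \<open>u\<close> as the subspace of the module and \<open>span gens\<close> as that of the
  algebra.\<close>

definition mfilt :: "nat \<Rightarrow> 'm set" where
  "mfilt m = mod.span {act v a | v a. v \<in> mod.span {u} \<and> a \<in> filt m}"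

lemma mfilt_eq: "mfilt m = mod.span (act u ` filt m)"
proof -
  have "{act v a | v a. v \<in> mod.span {u} \<and> a \<in> filt m} = act u ` filt m"
  proof (intro equalityI subsetI)
    fix w assume "w \<in> {act v a | v a. v \<in> mod.span {u} \<and> a \<in> filt m}"
    then obtain c a where "w = act (mscale c u) a" "a \<in> filt m"
      by (auto simp: mod.span_singleton)
    then show "w \<in> act u ` filt m"
      using subspace_scale[OF subspace_power_filtration] by (auto simp: act_mscale mscale_act)
  next
    fix w assume "w \<in> act u ` filt m"
    then show "w \<in> {act v a | v a. v \<in> mod.span {u} \<and> a \<in> filt m}"
      using mod.span_base[of u "{u}"] by blast
  qed
  then show ?thesis by (simp add: mfilt_def)
qed

lemma mfilt_mono: "m \<le> m' \<Longrightarrow> mfilt m \<subseteq> mfilt m'"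
  unfolding mfilt_eq by (intro mod.span_mono image_mono power_filtration_mono)

text \<open>Finite dimensionality is inherited from the algebra: the images of finitely many
  monomials acting on \<open>u\<close> span.\<close>

lemma mfilt_finite:
  obtains T where "finite T" "mfilt m \<subseteq> mod.span T"
proof -
  obtain l where l: "\<And>m. filt m \<subseteq> span (monomials (l * m))"
    using power_filtration_subset_monomials[OF findim_span_gens] by blast
  let ?T = "act u ` monomials (l * m)"
  have "act u a \<in> mod.span ?T" if "a \<in> span (monomials (l * m))" for a
    using that
  proof (induction rule: span_induct_alt)
    case base
    then show ?case by (simp add: mod.span_zero)
  next
    case (step c v b)
    have "act u (scale c v + b) = mscale c (act u v) + act u b"
      by (simp add: act_add_right mscale_act)
    moreover have "act u v \<in> mod.span ?T" using step(1) by (intro mod.span_base) blast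
    ultimately show ?case using step(2) by (simp add: mod.span_add mod.span_scale)
  qed
  then have "act u ` filt m \<subseteq> mod.span ?T" using l by blast
  then have "mfilt m \<subseteq> mod.span ?T"
    unfolding mfilt_eq by (intro mod.span_minimal mod.subspace_span)
  moreover have "finite ?T" using monomials_bound by blast
  ultimately show thesis using that by blast
qed

lemma mfilt_act:
  assumes "v \<in> mfilt m" "ka \<in> box D"
  shows "act v (mon ka) \<in> mfilt (m + 2 * n * D)"
  using assms(1) unfolding mfilt_eq[of m]
proof (induction rule: mod.span_induct_alt)
  case base
  then show ?case by (simp add: mfilt_def mod.span_zero)
next
  case (step c w v)
  from step(1) obtain a where a: "w = act u a" "a \<in> filt m" by blast
  obtain ws where ws: "mon ka = prod_list ws" "set ws \<subseteq> gens" "length ws \<le> 2 * n * D"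
    using mon_word[OF assms(2)] .
  have "a * mon ka \<in> filt (m + 2 * n * D)"
    unfolding ws(1) using a ws span_superset[of gens] by (intro power_filtration_mult) auto
  then have "act w (mon ka) \<in> mfilt (m + 2 * n * D)"
    unfolding mfilt_eq a(1) by (auto simp flip: act_mult intro!: mod.span_base)
  then show ?case
    using step(2) unfolding mfilt_def
    by (simp add: act_add_left act_mscale mod.span_add mod.span_scale)
qed

lemma dim_mfilt_mono:
  assumes "m \<le> m'" shows "mod.dim (mfilt m) \<le> mod.dim (mfilt m')"
proof -
  obtain B where B: "B \<subseteq> mfilt m" "mod.independent B" "card B = mod.dim (mfilt m)"
    by (rule mod.basis_exists[of "mfilt m"])
  obtain C where C: "C \<subseteq> mfilt m'" "mod.independent C" "mfilt m' \<subseteq> mod.span C" "card C = mod.dim (mfilt m')"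
    by (rule mod.basis_exists[of "mfilt m'"])
  obtain T where "finite T" "mfilt m' \<subseteq> mod.span T" using mfilt_finite by blast
  then have "finite C" using mod.independent_span_bound[OF _ C(2)] C(1) by blast
  then have "card B \<le> card C"
    using mod.independent_span_bound[OF _ B(2)] B(1) C(3) mfilt_mono[OF assms] by blast
  then show ?thesis using B C by simp
qed

text \<open>The monomials act as independent linear maps from step \<open>5 * n * D\<close>, where
  \<open>mon_independent_mod_ann\<close> applies, to step \<open>7 * n * D\<close>, since each is a
  word of length at most \<open>2 * n * D\<close>. Monotonicity of the dimension then gives a
  square.\<close>

lemma card_box_le_dim_mfilt: "card (box D) \<le> (mod.dim (mfilt (7 * n * D)))\<^sup>2"
proof -
  obtain T where T: "finite T" "mfilt (5 * n * D) \<subseteq> mod.span T" using mfilt_finite .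
  obtain T' where T': "finite T'" "mfilt (7 * n * D) \<subseteq> mod.span T'" using mfilt_finite .
  have "card (box D) \<le> mod.dim (mfilt (5 * n * D)) * mod.dim (mfilt (7 * n * D))"
  proof (rule mod.card_le_dim_mult_dim[OF T T', where f = "\<lambda>ka v. act v (mon ka)"])
    show "Vector_Spaces.linear mscale mscale (\<lambda>v. act v (mon ka))" for ka
      by unfold_locales (simp_all add: act_add_left act_mscale)
    show "act v (mon ka) \<in> mfilt (7 * n * D)" if "ka \<in> box D" "v \<in> mfilt (5 * n * D)" for ka v
      using mfilt_act[OF that(2,1)] by (simp add: algebra_simps)
    show "\<forall>ka\<in>box D. c ka = 0"
      if zero: "\<And>v. v \<in> mfilt (5 * n * D) \<Longrightarrow> (\<Sum>ka\<in>box D. mscale (c ka) (act v (mon ka))) = 0" for c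
    proof -
      have "(\<Sum>ka\<in>box D. scale (c ka) (mon ka)) \<in> ann (5 * n * D)"
        unfolding ann_def
      proof (intro CollectI allI impI)
        fix vs assume vs: "set vs \<subseteq> gens \<and> length vs \<le> 5 * n * D"
        then have "prod_list vs \<in> filt (5 * n * D)"
          using span_superset[of gens] by (intro prod_list_in_power_filtration) auto
        then have "act u (prod_list vs) \<in> mfilt (5 * n * D)"
          unfolding mfilt_eq by (intro mod.span_base) auto
        from zero[OF this] show "act u (prod_list vs * (\<Sum>ka\<in>box D. scale (c ka) (mon ka))) = 0"
          by (simp add: mscale_act act_sum_right act_mult)
      qed
      then show ?thesis using mon_independent_mod_ann[of c D] by blast
    qed
  qed (rule finite_box)
  also have "\<dots> \<le> mod.dim (mfilt (7 * n * D)) * mod.dim (mfilt (7 * n * D))"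
    by (rule mult_right_mono[OF dim_mfilt_mono]) auto
  finally show ?thesis by (simp add: power2_eq_square)
qed

lemma GKdim_module_ge: "ereal (real n) \<le> GKdim_module scale act"
proof -
  have "D ^ n \<le> mod.dim (mfilt (7 * n * D))" for D
  proof -
    have "(D ^ n)\<^sup>2 \<le> ((D + 1) ^ n)\<^sup>2" by (intro power_mono) auto
    also have "\<dots> = card (box D)" by (simp add: card_box power_mult mult.commute[of 2 n])
    also note card_box_le_dim_mfilt
    finally show ?thesis by (rule power2_le_imp_le) simp
  qed
  then have "ereal (real n) \<le> growth_exponent (\<lambda>m. mod.dim (mfilt m))"
    by (intro growth_exponent_ge[of "7 * n"]) (use n_pos in auto)
  also have "\<dots> \<le> GKdim_module scale act"
    unfolding GKdim_module_def mfilt_def using findim_span_gens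
    by (intro SUP_upper2[of "span gens"] SUP_upper2[of "mod.span {u}"])
      (auto simp: findim_subspace_def)
  finally show ?thesis .
qed

end

section \<open>The presentation\<close>

context kalgebra
begin

text \<open>Evaluating over a common finite set of words avoids following how the support changes
  under addition.\<close>

lemma eval_ncpoly_superset:
  assumes "finite S" "Poly_Mapping.keys f \<subseteq> S"
  shows "eval_ncpoly scale a f = (\<Sum>w\<in>S. scale (Poly_Mapping.lookup f w) (prod_list (map a w)))"
  unfolding eval_ncpoly_def using assms
  by (intro sum.mono_neutral_left) (auto simp: in_keys_iff)

lemma eval_ncpoly_add: "eval_ncpoly scale a (f + g) = eval_ncpoly scale a f + eval_ncpoly scale a g"
proof -
  let ?S = "Poly_Mapping.keys f \<union> Poly_Mapping.keys g"
  have "Poly_Mapping.keys (f + g) \<subseteq> ?S" by (rule Poly_Mapping.keys_add)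
  then show ?thesis
    by (simp add: eval_ncpoly_superset[of ?S] lookup_add scale_left_distrib sum.distrib)
qed

lemma eval_ncpoly_single:
  "eval_ncpoly scale a (Poly_Mapping.single w c) = scale c (prod_list (map a w))"
  by (subst eval_ncpoly_superset[of "{w}"]) auto

lemma eval_ncpoly_zero: "eval_ncpoly scale a 0 = 0"
  by (simp add: eval_ncpoly_def)

lemma eval_ncpoly_diff: "eval_ncpoly scale a (f - g) = eval_ncpoly scale a f - eval_ncpoly scale a g"
  using eval_ncpoly_add[of a "f - g" g] by simp

lemma eval_ncpoly_sum: "eval_ncpoly scale a (sum f I) = (\<Sum>i\<in>I. eval_ncpoly scale a (f i))"
  by (induction I rule: infinite_finite_induct) (auto simp: eval_ncpoly_zero eval_ncpoly_add)

lemma eval_ncpoly_Var_mult: "eval_ncpoly scale a (Var g * Var h) = a g * a h"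
  by (simp add: Var_def mult_single plus_list_def eval_ncpoly_single)

lemma eval_ncpoly_Const_mult:
  "eval_ncpoly scale a (Const c * (Var g * Var h)) = scale c (a g * a h)"
  by (simp add: Var_def Const_def mult_single plus_list_def eval_ncpoly_single)

lemmas eval_ncpoly_simps =
  eval_ncpoly_diff eval_ncpoly_sum eval_ncpoly_Var_mult eval_ncpoly_Const_mult

end

text \<open>A relation lies in the ideal it generates, with both cofactors equal to one, and this
  ideal is the kernel of evaluation.\<close>

lemma eval_ncpoly_relation:
  assumes "presented_by scale G R a" "r \<in> R"
  shows "eval_ncpoly scale a r = 0"
proof -
  have one: "1 \<in> free_algebra G" by (auto simp: free_algebra_def zero_list_def)
  have "0 + 1 * r * 1 \<in> relation_ideal G R"
    by (intro relation_ideal.intros one assms)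
  then show ?thesis using assms(1) by (auto simp: presented_by_def)
qed

text \<open>Evaluation is surjective, and a preimage has finitely many words; the longest one gives
  \<open>l\<close>.\<close>

lemma presented_by_generated:
  assumes "presented_by scale G R a"
  shows "\<exists>l. b \<in> power_filtration scale (a ` G) l"
proof -
  interpret kalgebra scale using assms by (simp add: presented_by_def)
  have "b \<in> eval_ncpoly scale a ` free_algebra G" using assms by (simp add: presented_by_def)
  then obtain f where f: "f \<in> free_algebra G" "b = eval_ncpoly scale a f" by blast
  define l where "l = Max (insert 0 (length ` Poly_Mapping.keys f))"
  have "prod_list (map a w) \<in> power_filtration scale (a ` G) l" if "w \<in> Poly_Mapping.keys f" for w
    using f that by (intro prod_list_in_power_filtration) (auto simp: free_algebra_def l_def)
  then have "b \<in> power_filtration scale (a ` G) l"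
    unfolding f(2) eval_ncpoly_def
    by (intro subspace_sum subspace_scale subspace_power_filtration)
  then show ?thesis by blast
qed

text \<open>Evaluating the defining relations at \<open>p i = 1\<close> gives the commutation rules,
  and surjectivity of evaluation gives generation by the \<open>x i\<close> and
  \<open>y i\<close>.\<close>

lemma is_Kn_kn_algebra:
  assumes par: "Kn_parameters n p q \<gamma>" and Kn: "is_Kn n p q \<gamma> scale x y"
    and p: "\<forall>i \<in> {1..n}. p i = 1" and q: "\<forall>i \<in> {1..n}. \<forall>k \<ge> 1. q i ^ k \<noteq> 1"
  shows "kn_algebra scale n q \<gamma> x y (\<lambda>i. \<Sum>l = 1..i. scale (q l - 1) (y l * x l))"
proof -
  have pres: "presented_by scale (Kn_gens n) (Kn_rels n p q \<gamma>) (case_Kn_gen x y)"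
    using Kn by (simp add: is_Kn_def)
  interpret kalgebra scale using pres by (simp add: presented_by_def)
  note rel = eval_ncpoly_relation[OF pres]
  note simps = eval_ncpoly_simps p[rule_format]
  show ?thesis
  proof unfold_locales
    show "q i \<noteq> 0" if "i \<in> {1..n}" for i using par that by (auto simp: Kn_parameters_def)
    show "q i ^ k \<noteq> 1" if "i \<in> {1..n}" "k \<ge> 1" for i k using q that by blast
    show "\<gamma> i j * \<gamma> j i = 1" if "i \<in> {1..n}" "j \<in> {1..n}" for i j
      using par that by (auto simp: Kn_parameters_def)
    show "x i * x j = scale (q i * \<gamma> i j) (x j * x i)" if "1 \<le> i" "i < j" "j \<le> n" for i j
    proof -
      have "X i * X j - Const (q i * inverse (p j) * \<gamma> i j) * (X j * X i) \<in> Kn_rels n p q \<gamma>"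
        using that unfolding Kn_rels_def by blast
      from rel[OF this] show ?thesis using that by (simp add: simps)
    qed
    show "y i * y j = scale (\<gamma> i j) (y j * y i)" if "1 \<le> i" "i < j" "j \<le> n" for i j
    proof -
      have "Y i * Y j - Const (\<gamma> i j) * (Y j * Y i) \<in> Kn_rels n p q \<gamma>"
        using that unfolding Kn_rels_def by blast
      from rel[OF this] show ?thesis using that by (simp add: simps)
    qed
    show "x i * y j = scale (inverse (\<gamma> i j)) (y j * x i)" if "1 \<le> i" "i < j" "j \<le> n" for i j
    proof -
      have "X i * Y j - Const (p j * inverse (\<gamma> i j)) * (Y j * X i) \<in> Kn_rels n p q \<gamma>"
        using that unfolding Kn_rels_def by blast
      from rel[OF this] show ?thesis using that by (simp add: simps)
    qed
    show "x i * y j = scale (q j * inverse (\<gamma> i j)) (y j * x i)" if "1 \<le> j" "j < i" "i \<le> n" for i j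
    proof -
      have "X i * Y j - Const (q j * inverse (\<gamma> i j)) * (Y j * X i) \<in> Kn_rels n p q \<gamma>"
        using that unfolding Kn_rels_def by blast
      from rel[OF this] show ?thesis using that by (simp add: simps)
    qed
    show "x i * y i = scale (q i) (y i * x i) + (\<Sum>l = 1..i - 1. scale (q l - 1) (y l * x l))"
      if "1 \<le> i" "i \<le> n" for i
    proof -
      have "X i * Y i - Const (q i) * (Y i * X i) - (\<Sum>l = 1..<i. Const (q l - p l) * (Y l * X l))
          \<in> Kn_rels n p q \<gamma>"
        using that unfolding Kn_rels_def by blast
      from rel[OF this]
      have "x i * y i = scale (q i) (y i * x i) + (\<Sum>l = 1..<i. scale (q l - p l) (y l * x l))"
        by (simp add: eval_ncpoly_simps diff_eq_eq add.commute)
      also have "(\<Sum>l = 1..<i. scale (q l - p l) (y l * x l))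
          = (\<Sum>l = 1..i - 1. scale (q l - 1) (y l * x l))"
        using that p by (intro sum.cong) auto
      finally show ?thesis .
    qed
    show "\<exists>l. a \<in> power_filtration scale (x ` {1..n} \<union> y ` {1..n}) l" for a
      using presented_by_generated[OF pres, of a]
      by (simp add: Kn_gens_def image_Un image_image)
  qed simp_all
qed

theorem mainTheorem1:
  fixes n :: nat
    and p q :: "nat \<Rightarrow> 'k::field"
    and \<gamma> :: "nat \<Rightarrow> nat \<Rightarrow> 'k"
    and scale :: "'k \<Rightarrow> 'a::ring_1 \<Rightarrow> 'a"
    and x y :: "nat \<Rightarrow> 'a"
    and act :: "'m::ab_group_add \<Rightarrow> 'a \<Rightarrow> 'm"
  assumes "n \<ge> 1"
    and "Kn_parameters n p q \<gamma>"
    and "is_Kn n p q \<gamma> scale x y"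
    and "\<forall>i \<in> {1..n}. p i = 1"
    and "\<forall>i \<in> {1..n}. \<forall>k \<ge> 1. q i ^ k \<noteq> 1"
    and "right_module act"
    and "\<exists>u :: 'm. u \<noteq> 0"
    and "fg_right_module act"
    and "\<not> torsion_module (Kn_Zset n p q scale x y) act"
  shows "GKdim_module scale act \<ge> ereal (real n) \<and>
         ereal (real n) = GKdim_algebra scale / 2"
proof -
  define z where "z i = (\<Sum>l = 1..i. scale (q l - 1) (y l * x l))" for i
  interpret kn_algebra scale n q \<gamma> x y z
    unfolding z_def using assms(2-5) by (rule is_Kn_kn_algebra)
  interpret right_module act by fact
  \<comment> \<open>Failure of torsion provides one vector that no element of \<open>Kn_Zset\<close>
    kills.\<close>
  obtain u where u: "\<And>s. s \<in> Kn_Zset n p q scale x y \<Longrightarrow> act u s \<noteq> 0"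
    using assms(9) by (auto simp: torsion_module_def)
  \<comment> \<open>With \<open>p i = 1\<close> the coefficients \<open>q l - p l\<close> become
    \<open>q l - 1\<close>, so every \<open>zmon k\<close> belongs to \<open>Kn_Zset\<close> and
    does not kill \<open>u\<close>.\<close>
  have "Kn_z p q scale x y i = z i" if "i \<in> {1..n}" for i
    unfolding Kn_z_def z_def using that assms(4) by (intro sum.cong) auto
  then have "zmon k = oprod n (\<lambda>i. Kn_z p q scale x y i ^ k i)" for k
    unfolding zmon_def by (intro oprod_cong) simp
  then have "zmon k \<in> Kn_Zset n p q scale x y" for k
    unfolding Kn_Zset_def oprod_def by blast
  then interpret kn_algebra_module scale n q \<gamma> x y z act u
    using u assms(1) by unfold_locales auto
  have "GKdim_algebra scale = ereal (real (2 * n))"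
    using GKdim_algebra_le GKdim_algebra_ge by (rule antisym)
  then show ?thesis using GKdim_module_ge by simp
qed

end
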